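(* Let $X$ be a non-empty $\Delta$-complex and let $R$ be a commutative ring with unit. Then the cochain algebra $A=C^*(X;R)$, with the usual cup product and coboundary and with Steenrod's cup-one products $\cup_1\colon A^p\otimes_R A^1\to A^p$ ($p=1,2$), is a $\cup_1$-dga.
   Context: A $\Delta$-set is a sequence of sets $X_n$ ($n\ge0$) of $n$-simplices with face maps $d_i\colon X_{n+1}\to X_n$, $0\le i\le n+1$, with $d_id_j=d_{j-1}d_i$ for $i<j$; a $\Delta$-complex is its geometric realization. $C_n(X)$ is free abelian on $X_n$ with $\partial=\sum_i(-1)^id_i$, and $C^n(X;R)=\mathrm{Hom}(C_n(X),R)$ with $(du)(x)=u(\partial x)$. For $u\in C^p$, $v\in C^q$, on a simplex with ordered vertices $0,\dots,p+q$: $(u\cup v)([0,\dots,p+q])=u([0,\dots,p])\cdot v([p,\dots,p+q])$. Steenrod's cup-one product is $$(u\cup_1 v)([0,\dots,p+q-1])=\sum_{j=0}^{p-1}(-1)^{(p-j)(q+1)}u([0,\dots,j,j+q,\dots,p+q-1])\cdot v([j,\dots,j+q]),$$ so in particular $(u\cup_1 v)(e)=u(e)v(e)$ for $1$-cochains $u,v$ and a $1$-simplex $e$. Graded $R$-algebras $A=\bigoplus_{i\ge0}A^i$ are associative and unital, with injective structure map $R\to A$, so that $R\subset A^0$; the product is denoted $a\cup b$. A differential graded $R$-algebra (dga) is a graded $R$-algebra with an $R$-linear degree $1$ map $d$ with $d^2=0$ and $d(a\cup b)=da\cup b+(-1)^{|a|}a\cup db$ for homogeneous $a,b$. $D^2(A)\subseteq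 A^2$ is the $R$-submodule spanned by all $a\cup b$ with $a,b\in A^1$. A graded algebra with cup-one products is a graded $R$-algebra $A$ with $R$-linear maps $\cup_1\colon A^p\otimes_R A^1\to A^p$ for $p=1,2$ such that (i) $(a\cup b)\cup_1 c=a\cup(b\cup_1 c)+(a\cup_1 c)\cup b$ for all $a,b,c\in A^1$; (ii) the $R$-module $R\oplus A^1$, with multiplication $(r+a)(s+b)=rs+(rb+sa+a\cup_1 b)$, is a commutative ring. A $\cup_1$-dga is a differential graded $R$-algebra $(A,d)$ such that $A$ is a graded algebra with cup-one products, there is an $R$-linear map $\circ\colon D^2(A)\otimes_R D^2(A)\to D^2(A)$ with $(u\cup v)\circ(w\cup z)=(u\cup_1 w)\cup(v\cup_1 z)$ for all $u,v,w,z\in A^1$, and $d(a\cup_1 b)=-a\cup b-b\cup a+da\cup_1 b+db\cup_1 a-da\circ db$ for all $a,b\in A^1$ with $da,db\in D^2(A)$. *)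

theory Defs
  imports "HOL-Algebra.Module" "HOL-Algebra.Free_Abelian_Groups"
begin

subsection \<open>Linear and bilinear maps\<close>

definition linear_map ::
  "('r, 'k) ring_scheme \<Rightarrow> ('r, 'a, 'm) module_scheme \<Rightarrow> ('r, 'b, 'n) module_scheme \<Rightarrow>
    ('a \<Rightarrow> 'b) \<Rightarrow> bool"
  where "linear_map R M N f \<longleftrightarrow>
    f \<in> carrier M \<rightarrow> carrier N \<and>
    (\<forall>x\<in>carrier M. \<forall>y\<in>carrier M. f (x \<oplus>\<^bsub>M\<^esub> y) = f x \<oplus>\<^bsub>N\<^esub> f y) \<and>
    (\<forall>r\<in>carrier R. \<forall>x\<in>carrier M. f (r \<odot>\<^bsub>M\<^esub> x) = r \<odot>\<^bsub>N\<^esub> f x)"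

text \<open>An \<open>R\<close>-linear map out of a tensor product \<open>M \<otimes>\<^sub>R N\<close> is rendered by the
  corresponding \<open>R\<close>-bilinear map on \<open>M \<times> N\<close>.\<close>

definition bilinear_map ::
  "('r, 'k) ring_scheme \<Rightarrow> ('r, 'a, 'm) module_scheme \<Rightarrow> ('r, 'b, 'n) module_scheme \<Rightarrow>
    ('r, 'c, 'l) module_scheme \<Rightarrow> ('a \<Rightarrow> 'b \<Rightarrow> 'c) \<Rightarrow> bool"
  where "bilinear_map R M N P f \<longleftrightarrow>
    (\<forall>x\<in>carrier M. linear_map R N P (f x)) \<and>
    (\<forall>y\<in>carrier N. linear_map R M P (\<lambda>x. f x y))"

definition module_span ::
  "('r, 'k) ring_scheme \<Rightarrow> ('r, 'a, 'm) module_scheme \<Rightarrow> 'a set \<Rightarrow> 'a set"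
  where "module_span R M S = \<Inter>{H. submodule H R M \<and> S \<subseteq> H}"

subsection \<open>Graded algebras and differential graded algebras\<close>

text \<open>A graded algebra is given by its homogeneous components \<open>A i\<close>, which all live in one
  ambient type but need not be disjoint, and by the components
  \<open>cup p q : A p \<times> A q \<rightarrow> A (p + q)\<close> of its product. The degrees are therefore explicit
  arguments of all operations. The structure map is \<open>r \<mapsto> r \<odot> unit\<close>.\<close>

locale graded_algebra = cring R
  for R :: "('r, 'k) ring_scheme" (structure)
    and A :: "nat \<Rightarrow> ('r, 'a, 'm) module_scheme"
    and cup :: "nat \<Rightarrow> nat \<Rightarrow> 'a \<Rightarrow> 'a \<Rightarrow> 'a"
    and unit :: 'a +
  assumes component_module: "module R (A p)"
    and cup_bilinear: "bilinear_map R (A p) (A q) (A (p + q)) (cup p q)"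
    and cup_assoc:
      "\<lbrakk>a \<in> carrier (A p); b \<in> carrier (A q); c \<in> carrier (A r)\<rbrakk> \<Longrightarrow>
        cup (p + q) r (cup p q a b) c = cup p (q + r) a (cup q r b c)"
    and unit_closed: "unit \<in> carrier (A 0)"
    and cup_unit_left: "a \<in> carrier (A p) \<Longrightarrow> cup 0 p unit a = a"
    and cup_unit_right: "a \<in> carrier (A p) \<Longrightarrow> cup p 0 a unit = a"
    and structure_map_inj: "inj_on (\<lambda>r. r \<odot>\<^bsub>A 0\<^esub> unit) (carrier R)"

locale dg_algebra = graded_algebra R A cup unit
  for R :: "('r, 'k) ring_scheme" (structure)
    and A :: "nat \<Rightarrow> ('r, 'a, 'm) module_scheme"
    and cup :: "nat \<Rightarrow> nat \<Rightarrow> 'a \<Rightarrow> 'a \<Rightarrow> 'a"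
    and unit :: 'a
    and d :: "nat \<Rightarrow> 'a \<Rightarrow> 'a" +
  assumes d_linear: "linear_map R (A p) (A (p + 1)) (d p)"
    and d_d: "a \<in> carrier (A p) \<Longrightarrow> d (p + 1) (d p a) = \<zero>\<^bsub>A (p + 2)\<^esub>"
    and d_cup:
      "\<lbrakk>a \<in> carrier (A p); b \<in> carrier (A q)\<rbrakk> \<Longrightarrow>
        d (p + q) (cup p q a b) =
          cup (p + 1) q (d p a) b
            \<oplus>\<^bsub>A (p + q + 1)\<^esub> ((\<ominus> \<one>) [^] p) \<odot>\<^bsub>A (p + q + 1)\<^esub> cup p (q + 1) a (d q b)"

definition decomposables ::
  "('r, 'k) ring_scheme \<Rightarrow> (nat \<Rightarrow> ('r, 'a, 'm) module_scheme) \<Rightarrow>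
    (nat \<Rightarrow> nat \<Rightarrow> 'a \<Rightarrow> 'a \<Rightarrow> 'a) \<Rightarrow> 'a set"
  where "decomposables R A cup =
    module_span R (A 2) {cup 1 1 a b |a b. a \<in> carrier (A 1) \<and> b \<in> carrier (A 1)}"

subsection \<open>Cup-one products\<close>

definition adjoin_scalars ::
  "('r, 'k) ring_scheme \<Rightarrow> ('r, 'a, 'm) module_scheme \<Rightarrow> ('a \<Rightarrow> 'a \<Rightarrow> 'a) \<Rightarrow> ('r \<times> 'a) ring"
  where "adjoin_scalars R M f =
    \<lparr>carrier = carrier R \<times> carrier M,
     monoid.mult = (\<lambda>(r, a) (s, b). (r \<otimes>\<^bsub>R\<^esub> s, (r \<odot>\<^bsub>M\<^esub> b \<oplus>\<^bsub>M\<^esub> s \<odot>\<^bsub>M\<^esub> a) \<oplus>\<^bsub>M\<^esub> f a b)),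
     one = (\<one>\<^bsub>R\<^esub>, \<zero>\<^bsub>M\<^esub>),
     ring.zero = (\<zero>\<^bsub>R\<^esub>, \<zero>\<^bsub>M\<^esub>),
     ring.add = (\<lambda>(r, a) (s, b). (r \<oplus>\<^bsub>R\<^esub> s, a \<oplus>\<^bsub>M\<^esub> b))\<rparr>"

text \<open>\<open>cup1 p\<close> is the product \<open>A p \<times> A 1 \<rightarrow> A p\<close>; only \<open>p = 1\<close> and \<open>p = 2\<close> are constrained.\<close>

locale graded_algebra_cup1 = graded_algebra R A cup unit
  for R :: "('r, 'k) ring_scheme" (structure)
    and A :: "nat \<Rightarrow> ('r, 'a, 'm) module_scheme"
    and cup :: "nat \<Rightarrow> nat \<Rightarrow> 'a \<Rightarrow> 'a \<Rightarrow> 'a"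
    and unit :: 'a
    and cup1 :: "nat \<Rightarrow> 'a \<Rightarrow> 'a \<Rightarrow> 'a" +
  assumes cup1_bilinear: "p \<in> {1, 2} \<Longrightarrow> bilinear_map R (A p) (A 1) (A p) (cup1 p)"
    and hirsch:
      "\<lbrakk>a \<in> carrier (A 1); b \<in> carrier (A 1); c \<in> carrier (A 1)\<rbrakk> \<Longrightarrow>
        cup1 2 (cup 1 1 a b) c = cup 1 1 a (cup1 1 b c) \<oplus>\<^bsub>A 2\<^esub> cup 1 1 (cup1 1 a c) b"
    and adjoin_scalars_cring: "cring (adjoin_scalars R (A 1) (cup1 1))"

locale cup1_dga = dg_algebra R A cup unit d + graded_algebra_cup1 R A cup unit cup1
  for R :: "('r, 'k) ring_scheme" (structure)
    and A :: "nat \<Rightarrow> ('r, 'a, 'm) module_scheme"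
    and cup :: "nat \<Rightarrow> nat \<Rightarrow> 'a \<Rightarrow> 'a \<Rightarrow> 'a"
    and unit :: 'a
    and d :: "nat \<Rightarrow> 'a \<Rightarrow> 'a"
    and cup1 :: "nat \<Rightarrow> 'a \<Rightarrow> 'a \<Rightarrow> 'a" +
  assumes circ_exists:
    "\<exists>circ.
      (let D2 = decomposables R A cup; D2_mod = (A 2)\<lparr>carrier := D2\<rparr> in
        bilinear_map R D2_mod D2_mod D2_mod circ \<and>
        (\<forall>u\<in>carrier (A 1). \<forall>v\<in>carrier (A 1). \<forall>w\<in>carrier (A 1). \<forall>z\<in>carrier (A 1).
          circ (cup 1 1 u v) (cup 1 1 w z) = cup 1 1 (cup1 1 u w) (cup1 1 v z)) \<and>
        (\<forall>a\<in>carrier (A 1). \<forall>b\<in>carrier (A 1). d 1 a \<in> D2 \<longrightarrow> d 1 b \<in> D2 \<longrightarrow>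
          d 1 (cup1 1 a b) =
            \<ominus>\<^bsub>A 2\<^esub> cup 1 1 a b \<ominus>\<^bsub>A 2\<^esub> cup 1 1 b a
              \<oplus>\<^bsub>A 2\<^esub> cup1 2 (d 1 a) b \<oplus>\<^bsub>A 2\<^esub> cup1 2 (d 1 b) a
              \<ominus>\<^bsub>A 2\<^esub> circ (d 1 a) (d 1 b)))"

subsection \<open>\<open>\<Delta>\<close>-sets and their cochains\<close>

text \<open>\<open>face n i\<close> is the face map \<open>d\<^sub>i\<close> from \<open>X (n + 1)\<close> to \<open>X n\<close>.\<close>

locale delta_set =
  fixes X :: "nat \<Rightarrow> 'x set"
    and face :: "nat \<Rightarrow> nat \<Rightarrow> 'x \<Rightarrow> 'x"
  assumes face_closed: "\<lbrakk>x \<in> X (n + 1); i \<le> n + 1\<rbrakk> \<Longrightarrow> face n i x \<in> X n"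
    and face_face:
      "\<lbrakk>x \<in> X (n + 2); i < j; j \<le> n + 2\<rbrakk> \<Longrightarrow>
        face n i (face (n + 1) j x) = face n (j - 1) (face (n + 1) i x)"

definition boundary ::
  "(nat \<Rightarrow> nat \<Rightarrow> 'x \<Rightarrow> 'x) \<Rightarrow> nat \<Rightarrow> ('x \<Rightarrow>\<^sub>0 int) \<Rightarrow> ('x \<Rightarrow>\<^sub>0 int)"
  where "boundary face n =
    frag_extend (\<lambda>x. \<Sum>i = 0..n + 1. frag_cmul ((- 1) ^ i) (frag_of (face n i x)))"

text \<open>Cochains are homomorphisms on the chain group; they are taken to be extensional
  (undefined off the chain group) so that equal homomorphisms are equal functions.
  The fields \<open>mult\<close> and \<open>one\<close> of the module record play no role.\<close>

definition cochains ::
  "('r, 'k) ring_scheme \<Rightarrow> (nat \<Rightarrow> 'x set) \<Rightarrow> nat \<Rightarrow> ('r, ('x \<Rightarrow>\<^sub>0 int) \<Rightarrow> 'r) module"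
  where "cochains R X n =
    (let C = free_Abelian_group (X n) in
    \<lparr>carrier = hom C (add_monoid R) \<inter> extensional (carrier C),
     monoid.mult = undefined,
     one = undefined,
     ring.zero = (\<lambda>c\<in>carrier C. \<zero>\<^bsub>R\<^esub>),
     ring.add = (\<lambda>u v. \<lambda>c\<in>carrier C. u c \<oplus>\<^bsub>R\<^esub> v c),
     smult = (\<lambda>r u. \<lambda>c\<in>carrier C. r \<otimes>\<^bsub>R\<^esub> u c)\<rparr>)"

text \<open>The cochain with prescribed values on the simplices.\<close>

definition cochain_of ::
  "('r, 'k) ring_scheme \<Rightarrow> 'x set \<Rightarrow> ('x \<Rightarrow> 'r) \<Rightarrow> (('x \<Rightarrow>\<^sub>0 int) \<Rightarrow> 'r)"
  where "cochain_of R S f =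
    (\<lambda>c\<in>carrier (free_Abelian_group S).
      \<Oplus>\<^bsub>R\<^esub>x\<in>Poly_Mapping.keys c. [Poly_Mapping.lookup c x] \<cdot>\<^bsub>R\<^esub> f x)"

lemma cochain_of_frag_of:
  assumes "cring R" "x \<in> S" "f x \<in> carrier R"
  shows "cochain_of R S f (frag_of x) = f x"
proof -
  interpret cring R by fact
  have "(1::int) = int 1" by simp
  then have "[(1::int)] \<cdot>\<^bsub>R\<^esub> f x = f x"
    using assms(3) by (metis add.int_pow_1)
  then show ?thesis
    using assms by (simp add: cochain_of_def)
qed

definition coboundary ::
  "(nat \<Rightarrow> 'x set) \<Rightarrow> (nat \<Rightarrow> nat \<Rightarrow> 'x \<Rightarrow> 'x) \<Rightarrow> nat \<Rightarrow>
    (('x \<Rightarrow>\<^sub>0 int) \<Rightarrow> 'r) \<Rightarrow> (('x \<Rightarrow>\<^sub>0 int) \<Rightarrow> 'r)"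
  where "coboundary X face n u =
    (\<lambda>c\<in>carrier (free_Abelian_group (X (n + 1))). u (boundary face n c))"

text \<open>\<open>subface face n V x\<close> is the face of the \<open>n\<close>-simplex \<open>x\<close> spanned by the vertices
  in \<open>V \<subseteq> {0..n}\<close>: the remaining vertices are deleted one at a time, largest first, so that
  the positions of the vertices still to be deleted do not shift.\<close>

primrec delete_vertices ::
  "(nat \<Rightarrow> nat \<Rightarrow> 'x \<Rightarrow> 'x) \<Rightarrow> nat list \<Rightarrow> nat \<Rightarrow> 'x \<Rightarrow> 'x"
  where
    "delete_vertices face [] n x = x"
  | "delete_vertices face (i # is) n x = delete_vertices face is (n - 1) (face (n - 1) i x)"

definition subface ::
  "(nat \<Rightarrow> nat \<Rightarrow> 'x \<Rightarrow> 'x) \<Rightarrow> nat \<Rightarrow> nat set \<Rightarrow> 'x \<Rightarrow> 'x"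
  where "subface face n V x =
    delete_vertices face (rev (sorted_list_of_set ({0..n} - V))) n x"

definition cup_product ::
  "('r, 'k) ring_scheme \<Rightarrow> (nat \<Rightarrow> 'x set) \<Rightarrow> (nat \<Rightarrow> nat \<Rightarrow> 'x \<Rightarrow> 'x) \<Rightarrow> nat \<Rightarrow> nat \<Rightarrow>
    (('x \<Rightarrow>\<^sub>0 int) \<Rightarrow> 'r) \<Rightarrow> (('x \<Rightarrow>\<^sub>0 int) \<Rightarrow> 'r) \<Rightarrow> (('x \<Rightarrow>\<^sub>0 int) \<Rightarrow> 'r)"
  where "cup_product R X face p q u v =
    cochain_of R (X (p + q)) (\<lambda>x.
      u (frag_of (subface face (p + q) {0..p} x))
        \<otimes>\<^bsub>R\<^esub> v (frag_of (subface face (p + q) {p..p + q} x)))"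

definition unit_cochain ::
  "('r, 'k) ring_scheme \<Rightarrow> (nat \<Rightarrow> 'x set) \<Rightarrow> (('x \<Rightarrow>\<^sub>0 int) \<Rightarrow> 'r)"
  where "unit_cochain R X = cochain_of R (X 0) (\<lambda>x. \<one>\<^bsub>R\<^esub>)"

text \<open>Steenrod's cup-one product \<open>C\<^sup>p \<times> C\<^sup>q \<rightarrow> C\<^sup>p\<^sup>+\<^sup>q\<^sup>-\<^sup>1\<close>, meaningful for \<open>p + q \<ge> 1\<close>.\<close>

definition steenrod_cup1 ::
  "('r, 'k) ring_scheme \<Rightarrow> (nat \<Rightarrow> 'x set) \<Rightarrow> (nat \<Rightarrow> nat \<Rightarrow> 'x \<Rightarrow> 'x) \<Rightarrow> nat \<Rightarrow> nat \<Rightarrow>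
    (('x \<Rightarrow>\<^sub>0 int) \<Rightarrow> 'r) \<Rightarrow> (('x \<Rightarrow>\<^sub>0 int) \<Rightarrow> 'r) \<Rightarrow> (('x \<Rightarrow>\<^sub>0 int) \<Rightarrow> 'r)"
  where "steenrod_cup1 R X face p q u v =
    cochain_of R (X (p + q - 1)) (\<lambda>x.
      \<Oplus>\<^bsub>R\<^esub>j\<in>{..<p}.
        ((\<ominus>\<^bsub>R\<^esub> \<one>\<^bsub>R\<^esub>) [^]\<^bsub>R\<^esub> ((p - j) * (q + 1)))
          \<otimes>\<^bsub>R\<^esub> (u (frag_of (subface face (p + q - 1) ({0..j} \<union> {j + q..p + q - 1}) x))
            \<otimes>\<^bsub>R\<^esub> v (frag_of (subface face (p + q - 1) {j..j + q} x))))"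

end

theory Submission
  imports Defs
begin

text \<open>The chain group is free, so a cochain is determined by its values on simplices
  (\<open>cochain_eqI\<close>), and every function on the simplices is the restriction of a cochain
  (\<open>cochain_of_closed\<close>). Equations between cochains can therefore be checked as identities in \<open>R\<close>
  on each simplex. The structure map \<open>R \<rightarrow> C\<^sup>0\<close> is injective because a non-empty \<open>\<Delta>\<close>-set has a
  vertex, on which the unit cochain takes the value \<open>1\<close>.

  For the differential graded algebra, the simplicial identities describe how front and back faces
  interact with each other and with the face maps. Associativity of the cup product is then
  immediate, and the Leibniz rule (\<open>coboundary_cup\<close>) is the usual splitting of the boundary of a
  \<open>(p + q + 1)\<close>-simplex into the faces opposite to a vertex \<open>\<le> p\<close> and those opposite to a
  vertex \<open>> p\<close>.

  For a \<open>p\<close>-cochain \<open>u\<close> and a \<open>1\<close>-cochain \<open>v\<close>, the value of \<open>u \<union>\<^sub>1 v\<close> on a simplex \<open>x\<close> is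
  \<open>u(x)\<close> times the sum of the values of \<open>v\<close> on the edges \<open>[j, j + 1]\<close> of \<open>x\<close> (\<open>cup1_value\<close>). For
  \<open>p = 1\<close> this is the pointwise product, so \<open>R \<oplus> C\<^sup>1\<close> is a commutative ring; for \<open>p = 2\<close> the
  Hirsch identity reads \<open>a\<^sub>0\<^sub>1 b\<^sub>1\<^sub>2 (c\<^sub>0\<^sub>1 + c\<^sub>1\<^sub>2) = a\<^sub>0\<^sub>1 b\<^sub>1\<^sub>2 c\<^sub>1\<^sub>2 + a\<^sub>0\<^sub>1 c\<^sub>0\<^sub>1 b\<^sub>1\<^sub>2\<close>. The operation
  \<open>\<circ>\<close> is the pointwise product of \<open>2\<close>-cochains, which preserves the span of the decomposable
  elements (\<open>pointwise_product_decomposables\<close>). With this choice the formula for \<open>d (a \<union>\<^sub>1 b)\<close>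
  holds for all \<open>1\<close>-cochains, whether or not their coboundaries are decomposable: it results from
  substituting \<open>a\<^sub>0\<^sub>2 = a\<^sub>0\<^sub>1 + a\<^sub>1\<^sub>2 - da\<close> and \<open>b\<^sub>0\<^sub>2 = b\<^sub>0\<^sub>1 + b\<^sub>1\<^sub>2 - db\<close> into the product
  \<open>a\<^sub>0\<^sub>2 b\<^sub>0\<^sub>2\<close> (\<open>edge_identity\<close>).\<close>

section \<open>Identities in commutative rings\<close>

context cring
begin

lemma finsum_split:
  fixes f :: "nat \<Rightarrow> 'a"
  assumes "f \<in> {..Suc (m + n)} \<rightarrow> carrier R"
  shows "finsum R f {..Suc (m + n)} = finsum R f {..m} \<oplus> (\<Oplus>i\<in>{..n}. f (Suc m + i))"
  using assms
proof (induction n)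
  case (Suc n)
  then have "f \<in> {..m} \<rightarrow> carrier R" "(\<lambda>i. f (Suc m + i)) \<in> {..n} \<rightarrow> carrier R"
    "f (Suc (Suc (m + n))) \<in> carrier R" "f \<in> {..Suc (m + n)} \<rightarrow> carrier R"
    by auto
  with Suc show ?case
    by (simp add: a_ac Pi_def)
qed (simp add: a_ac Pi_def)

lemma even_sign: "(\<ominus> \<one>) [^] (k * (1 + 1)) = \<one>" for k :: nat
proof -
  have "(\<ominus> \<one>) [^] (2 :: nat) = \<one>"
    by (simp add: numeral_2_eq_2 l_minus)
  then have "((\<ominus> \<one>) [^] (2 :: nat)) [^] k = \<one>"
    by simp
  then show ?thesis
    using nat_pow_pow[of "\<ominus> \<one>" 2 k] by (simp only: one_add_one mult.commute a_inv_closed one_closed)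
qed

text \<open>This is the formula for \<open>d (a \<union>\<^sub>1 b)\<close> on a \<open>2\<close>-simplex, where \<open>p, q, t\<close> are the values of
  a \<open>1\<close>-cochain \<open>a\<close> on the edges \<open>01\<close>, \<open>12\<close>, \<open>02\<close>, and \<open>p', q', t'\<close> those of \<open>b\<close>.\<close>

lemma edge_identity:
  assumes "p \<in> carrier R" "q \<in> carrier R" "t \<in> carrier R"
    "p' \<in> carrier R" "q' \<in> carrier R" "t' \<in> carrier R"
  shows "p \<otimes> p' \<oplus> q \<otimes> q' \<ominus> t \<otimes> t' =
    \<ominus> (p \<otimes> q') \<ominus> p' \<otimes> q
      \<oplus> (p \<oplus> q \<ominus> t) \<otimes> (p' \<oplus> q') \<oplus> (p' \<oplus> q' \<ominus> t') \<otimes> (p \<oplus> q)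
      \<ominus> (p \<oplus> q \<ominus> t) \<otimes> (p' \<oplus> q' \<ominus> t')"
proof -
  define A where "A = p \<oplus> q"
  define B where "B = p' \<oplus> q'"
  \<comment> \<open>\<open>c\<close> is the value of \<open>da\<close>; keeping it unexpanded leaves few terms to normalize.\<close>
  define c where "c = A \<ominus> t"
  have closed: "A \<in> carrier R" "B \<in> carrier R" "c \<in> carrier R" and t: "t = A \<ominus> c"
    unfolding c_def A_def B_def using assms by (simp_all, algebra)
  have "c \<otimes> B \<oplus> (B \<ominus> t') \<otimes> A \<ominus> c \<otimes> (B \<ominus> t') = (B \<ominus> t') \<otimes> A \<oplus> c \<otimes> t'"
    using assms closed by algebra
  also have "\<dots> = A \<otimes> B \<ominus> (A \<ominus> c) \<otimes> t'"
    using assms closed by algebra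
  finally have *: "c \<otimes> B \<oplus> (B \<ominus> t') \<otimes> A \<ominus> c \<otimes> (B \<ominus> t') = A \<otimes> B \<ominus> t \<otimes> t'"
    unfolding t[symmetric] .
  have "p \<otimes> p' \<oplus> q \<otimes> q' \<ominus> t \<otimes> t' = \<ominus> (p \<otimes> q') \<ominus> p' \<otimes> q \<oplus> (A \<otimes> B \<ominus> t \<otimes> t')"
    unfolding A_def B_def using assms by algebra
  also have "\<dots> = \<ominus> (p \<otimes> q') \<ominus> p' \<otimes> q \<oplus> c \<otimes> B \<oplus> (B \<ominus> t') \<otimes> A \<ominus> c \<otimes> (B \<ominus> t')"
    unfolding *[symmetric] using assms closed by (simp add: a_minus_def a_assoc)
  finally show ?thesis
    unfolding c_def A_def B_def .
qed

end

section \<open>Cochains as functions on simplices\<close>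

lemma keys_add_subset:
  "\<lbrakk>Poly_Mapping.keys a \<subseteq> S; Poly_Mapping.keys b \<subseteq> S\<rbrakk> \<Longrightarrow> Poly_Mapping.keys (a + b) \<subseteq> S"
  using keys_add[of a b] by blast

context cring
begin

lemma cochain_iff:
  "u \<in> carrier (cochains R X n) \<longleftrightarrow>
    u \<in> hom (free_Abelian_group (X n)) (add_monoid R) \<and>
    u \<in> extensional (carrier (free_Abelian_group (X n)))"
  by (simp add: cochains_def Let_def)

lemma cochain_closed:
  assumes "u \<in> carrier (cochains R X n)" "Poly_Mapping.keys c \<subseteq> X n"
  shows "u c \<in> carrier R"
  using assms hom_in_carrier[of u "free_Abelian_group (X n)" "add_monoid R" c]
  by (simp add: cochain_iff)

lemma cochain_value_closed [simp]:
  "\<lbrakk>u \<in> carrier (cochains R X n); x \<in> X n\<rbrakk> \<Longrightarrow> u (frag_of x) \<in> carrier R"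
  by (simp add: cochain_closed)

lemma cochain_group_hom:
  assumes "u \<in> carrier (cochains R X n)"
  shows "group_hom (free_Abelian_group (X n)) (add_monoid R) u"
  using assms by (simp add: group_hom_def group_hom_axioms_def cochain_iff add.is_group)

lemma cochain_0 [simp]:
  assumes "u \<in> carrier (cochains R X n)"
  shows "u 0 = \<zero>"
  using group_hom.hom_one[OF cochain_group_hom[OF assms]] by simp

lemma cochain_add:
  assumes "u \<in> carrier (cochains R X n)" "Poly_Mapping.keys a \<subseteq> X n" "Poly_Mapping.keys b \<subseteq> X n"
  shows "u (a + b) = u a \<oplus> u b"
  using group_hom.hom_mult[OF cochain_group_hom[OF assms(1)], of a b] assms by simp

lemma cochain_minus:
  assumes "u \<in> carrier (cochains R X n)" "Poly_Mapping.keys a \<subseteq> X n"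
  shows "u (- a) = \<ominus> u a"
  using group_hom.hom_inv[OF cochain_group_hom[OF assms(1)], of a] assms by (simp add: a_inv_def)

lemma cochain_sign:
  assumes "u \<in> carrier (cochains R X n)" "x \<in> X n"
  shows "u (frag_cmul ((- 1) ^ i) (frag_of x)) = ((\<ominus> \<one>) [^] i) \<otimes> u (frag_of x)"
proof (induction i)
  case (Suc i)
  have "u (frag_cmul ((- 1) ^ Suc i) (frag_of x)) = u (- frag_cmul ((- 1) ^ i) (frag_of x))"
    by simp
  also have "\<dots> = \<ominus> (((\<ominus> \<one>) [^] i) \<otimes> u (frag_of x))"
    using assms Suc by (subst cochain_minus) (auto split: if_splits)
  also have "\<dots> = ((\<ominus> \<one>) [^] Suc i) \<otimes> u (frag_of x)"
    using assms by (simp add: l_minus r_minus)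
  finally show ?case .
qed (use assms in simp)

lemma cochain_sum:
  assumes "u \<in> carrier (cochains R X n)" "finite I" "\<And>i. i \<in> I \<Longrightarrow> Poly_Mapping.keys (c i) \<subseteq> X n"
  shows "u (\<Sum>i\<in>I. c i) = (\<Oplus>i\<in>I. u (c i))"
  using assms(2,3)
proof (induction I rule: finite_induct)
  case (insert i I)
  have "Poly_Mapping.keys (\<Sum>i\<in>I. c i) \<subseteq> X n"
    using sum_closed_free_Abelian_group[of I c "X n"] insert.prems by simp
  moreover have "(\<lambda>i. u (c i)) \<in> I \<rightarrow> carrier R"
    using insert.prems assms(1) by (auto intro: cochain_closed)
  ultimately show ?case
    using insert assms(1) by (simp add: cochain_add cochain_closed)
qed (use assms(1) in simp)

lemma cochain_eqI:
  assumes "u \<in> carrier (cochains R X n)" "v \<in> carrier (cochains R X n)"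
    and "\<And>x. x \<in> X n \<Longrightarrow> u (frag_of x) = v (frag_of x)"
  shows "u = v"
proof (rule extensionalityI)
  show "u \<in> extensional (carrier (free_Abelian_group (X n)))"
    "v \<in> extensional (carrier (free_Abelian_group (X n)))"
    using assms by (simp_all add: cochain_iff)
next
  fix c assume "c \<in> carrier (free_Abelian_group (X n))"
  then have "Poly_Mapping.keys c \<subseteq> X n" by simp
  then show "u c = v c"
  proof (rule free_Abelian_group_induct)
    fix a b assume "Poly_Mapping.keys a \<subseteq> X n" "Poly_Mapping.keys b \<subseteq> X n" "u a = v a" "u b = v b"
    then have "u (a + - b) = v (a + - b)"
      using assms by (simp only: cochain_add cochain_minus keys_minus)
    then show "u (a - b) = v (a - b)" by simp
  qed (use assms in simp_all)
qed

text \<open>The freeness of the chain group: every function on the simplices extends to a cochain.\<close>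

lemma cochain_of_closed:
  fixes X :: "nat \<Rightarrow> 'x set"
  assumes "\<And>x. x \<in> X n \<Longrightarrow> f x \<in> carrier R"
  shows "cochain_of R (X n) f \<in> carrier (cochains R X n)"
proof -
  have eq: "(\<Oplus>x\<in>Poly_Mapping.keys c. [Poly_Mapping.lookup c x] \<cdot> f x) =
      (\<Oplus>x\<in>K. [Poly_Mapping.lookup c x] \<cdot> f x)"
    if "Poly_Mapping.keys c \<subseteq> K" "finite K" "K \<subseteq> X n" for c :: "'x \<Rightarrow>\<^sub>0 int" and K
  proof (rule add.finprod_mono_neutral_cong_left)
    show "[Poly_Mapping.lookup c x] \<cdot> f x = \<zero>" if "x \<in> K - Poly_Mapping.keys c" for x
      using that by (simp add: in_keys_iff add_pow_def int_pow_def nat_pow_def)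
    show "(\<lambda>x. [Poly_Mapping.lookup c x] \<cdot> f x) \<in> K \<rightarrow> carrier R"
      using that assms by (auto intro!: add.int_pow_closed)
  qed (use that in auto)
  show ?thesis
    unfolding cochain_iff
  proof
    show "cochain_of R (X n) f \<in> hom (free_Abelian_group (X n)) (add_monoid R)"
    proof (rule homI)
      fix a b assume a: "a \<in> carrier (free_Abelian_group (X n))"
        and b: "b \<in> carrier (free_Abelian_group (X n))"
      define K where "K = Poly_Mapping.keys a \<union> Poly_Mapping.keys b"
      have K: "finite K" "K \<subseteq> X n" "Poly_Mapping.keys a \<subseteq> K" "Poly_Mapping.keys b \<subseteq> K"
        "Poly_Mapping.keys (a + b) \<subseteq> K" "Poly_Mapping.keys (a + b) \<subseteq> X n"
        using a b keys_add[of a b] by (auto simp: K_def)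
      have f: "f x \<in> carrier R" if "x \<in> K" for x
        using that K assms by auto
      show "cochain_of R (X n) f (a \<otimes>\<^bsub>free_Abelian_group (X n)\<^esub> b) =
          cochain_of R (X n) f a \<otimes>\<^bsub>add_monoid R\<^esub> cochain_of R (X n) f b"
        using a b K f
        by (simp add: cochain_of_def eq[of _ K] lookup_add add.int_pow_mult finsum_addf Pi_def
            cong: finsum_cong)
    qed (use assms in \<open>auto simp: cochain_of_def intro!: finsum_closed\<close>)
  qed (simp add: cochain_of_def)
qed

lemma cochain_of_value [simp]:
  "\<lbrakk>x \<in> S; f x \<in> carrier R\<rbrakk> \<Longrightarrow> cochain_of R S f (frag_of x) = f x"
  by (rule cochain_of_frag_of[OF is_cring])

lemma cochains_add_closed:
  assumes "u \<in> carrier (cochains R X n)" "v \<in> carrier (cochains R X n)"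
  shows "u \<oplus>\<^bsub>cochains R X n\<^esub> v \<in> carrier (cochains R X n)"
proof -
  have "(\<lambda>c\<in>carrier (free_Abelian_group (X n)). u c \<oplus> v c)
      \<in> hom (free_Abelian_group (X n)) (add_monoid R)"
  proof (rule homI)
    fix a b assume ab: "a \<in> carrier (free_Abelian_group (X n))"
      "b \<in> carrier (free_Abelian_group (X n))"
    then have "a + b \<in> carrier (free_Abelian_group (X n))"
      by (simp add: keys_add_subset)
    with ab show "(\<lambda>c\<in>carrier (free_Abelian_group (X n)). u c \<oplus> v c)
        (a \<otimes>\<^bsub>free_Abelian_group (X n)\<^esub> b) =
      (\<lambda>c\<in>carrier (free_Abelian_group (X n)). u c \<oplus> v c) a \<otimes>\<^bsub>add_monoid R\<^esub>
      (\<lambda>c\<in>carrier (free_Abelian_group (X n)). u c \<oplus> v c) b"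
      using assms
      by (simp add: cochain_add cochain_closed a_ac)
  qed (use assms in \<open>simp add: cochain_closed\<close>)
  then show ?thesis
    by (simp add: cochains_def Let_def)
qed

lemma cochains_smult_closed:
  assumes "r \<in> carrier R" "u \<in> carrier (cochains R X n)"
  shows "r \<odot>\<^bsub>cochains R X n\<^esub> u \<in> carrier (cochains R X n)"
proof -
  have "(\<lambda>c\<in>carrier (free_Abelian_group (X n)). r \<otimes> u c)
      \<in> hom (free_Abelian_group (X n)) (add_monoid R)"
  proof (rule homI)
    fix a b assume ab: "a \<in> carrier (free_Abelian_group (X n))"
      "b \<in> carrier (free_Abelian_group (X n))"
    then have "a + b \<in> carrier (free_Abelian_group (X n))"
      by (simp add: keys_add_subset)
    with ab show "(\<lambda>c\<in>carrier (free_Abelian_group (X n)). r \<otimes> u c)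
        (a \<otimes>\<^bsub>free_Abelian_group (X n)\<^esub> b) =
      (\<lambda>c\<in>carrier (free_Abelian_group (X n)). r \<otimes> u c) a \<otimes>\<^bsub>add_monoid R\<^esub>
      (\<lambda>c\<in>carrier (free_Abelian_group (X n)). r \<otimes> u c) b"
      using assms by (simp add: cochain_add cochain_closed r_distr)
  qed (use assms in \<open>simp add: cochain_closed\<close>)
  then show ?thesis
    by (simp add: cochains_def Let_def)
qed

lemma cochains_zero_closed: "\<zero>\<^bsub>cochains R X n\<^esub> \<in> carrier (cochains R X n)"
  by (auto simp: cochains_def Let_def keys_add_subset[THEN subsetD] intro!: homI)

lemma cochains_add_value [simp]:
  "x \<in> X n \<Longrightarrow> (u \<oplus>\<^bsub>cochains R X n\<^esub> v) (frag_of x) = u (frag_of x) \<oplus> v (frag_of x)"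
  by (simp add: cochains_def Let_def)

lemma cochains_smult_value [simp]:
  "x \<in> X n \<Longrightarrow> (r \<odot>\<^bsub>cochains R X n\<^esub> u) (frag_of x) = r \<otimes> u (frag_of x)"
  by (simp add: cochains_def Let_def)

lemma cochains_zero_value [simp]:
  "x \<in> X n \<Longrightarrow> \<zero>\<^bsub>cochains R X n\<^esub> (frag_of x) = \<zero>"
  by (simp add: cochains_def Let_def)

lemma module_cochains: "module R (cochains R X n)"
proof (rule moduleI)
  let ?M = "cochains R X n"
  note closed = cochains_add_closed cochains_smult_closed cochains_zero_closed
  show "abelian_group ?M"
  proof (rule abelian_groupI)
    fix u assume u: "u \<in> carrier ?M"
    show "\<exists>v\<in>carrier ?M. v \<oplus>\<^bsub>?M\<^esub> u = \<zero>\<^bsub>?M\<^esub>"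
    proof
      show "(\<ominus> \<one>) \<odot>\<^bsub>?M\<^esub> u \<in> carrier ?M"
        using u by (simp add: closed)
      show "((\<ominus> \<one>) \<odot>\<^bsub>?M\<^esub> u) \<oplus>\<^bsub>?M\<^esub> u = \<zero>\<^bsub>?M\<^esub>"
        using u
        by (intro cochain_eqI[where X = X and n = n]) (simp_all add: closed l_minus l_neg)
    qed
  qed (auto simp: closed a_ac intro!: cochain_eqI[where X = X and n = n])
qed (auto simp: cochains_add_closed cochains_smult_closed is_cring l_distr r_distr m_assoc
    intro!: cochain_eqI[where X = X and n = n])

lemma cochains_neg_value:
  assumes "u \<in> carrier (cochains R X n)" "x \<in> X n"
  shows "(\<ominus>\<^bsub>cochains R X n\<^esub> u) (frag_of x) = \<ominus> u (frag_of x)"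
proof -
  interpret M: module R "cochains R X n"
    by (rule module_cochains)
  have "(\<ominus>\<^bsub>cochains R X n\<^esub> u \<oplus>\<^bsub>cochains R X n\<^esub> u) (frag_of x) = \<zero>"
    using assms by (simp only: M.l_neg cochains_zero_value)
  then have "(\<ominus>\<^bsub>cochains R X n\<^esub> u) (frag_of x) \<oplus> u (frag_of x) = \<zero>"
    using assms by simp
  then show ?thesis
    using assms M.a_inv_closed[OF assms(1)]
    by (metis minus_equality cochain_value_closed)
qed

lemma cochains_diff_value:
  assumes "u \<in> carrier (cochains R X n)" "v \<in> carrier (cochains R X n)" "x \<in> X n"
  shows "(u \<ominus>\<^bsub>cochains R X n\<^esub> v) (frag_of x) = u (frag_of x) \<ominus> v (frag_of x)"
  using assms by (simp add: a_minus_def cochains_neg_value)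

end

section \<open>Front and back faces\<close>

context delta_set
begin

text \<open>The front \<open>p\<close>-face, spanned by the first \<open>p + 1\<close> vertices of a \<open>(p + q)\<close>-simplex, and the
  back \<open>q\<close>-face, spanned by its last \<open>q + 1\<close> vertices. Both degrees are arguments, and \<open>p + q\<close> is
  the dimension of the simplex.\<close>

definition front_face :: "nat \<Rightarrow> nat \<Rightarrow> 'x \<Rightarrow> 'x"
  where "front_face p q = subface face (p + q) {0..p}"

definition back_face :: "nat \<Rightarrow> nat \<Rightarrow> 'x \<Rightarrow> 'x"
  where "back_face p q = subface face (p + q) {p..p + q}"

lemma front_0 [simp]: "front_face p 0 x = x"
  by (simp add: front_face_def back_face_def subface_def)

lemma back_0 [simp]: "back_face 0 q x = x"
  by (simp add: front_face_def back_face_def subface_def)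

lemma front_Suc: "front_face p (Suc q) x = front_face p q (face (p + q) (Suc (p + q)) x)"
proof -
  have "{0..p + Suc q} - {0..p} = {Suc p..<Suc (p + Suc q)}"
    "{0..p + q} - {0..p} = {Suc p..<Suc (p + q)}"
    by auto
  then show ?thesis
    by (simp add: front_face_def back_face_def subface_def)
qed

lemma back_Suc: "back_face (Suc p) q x = back_face p q (face (p + q) p x)"
proof -
  have "{0..Suc p + q} - {Suc p..Suc p + q} = {0..<Suc p}" "{0..p + q} - {p..p + q} = {0..<p}"
    by auto
  then show ?thesis
    by (simp add: front_face_def back_face_def subface_def)
qed

lemma front_closed [simp]: "x \<in> X (p + q) \<Longrightarrow> front_face p q x \<in> X p"
proof (induction q arbitrary: x)
  case (Suc q)
  then have "face (p + q) (Suc (p + q)) x \<in> X (p + q)"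
    by (intro face_closed) auto
  then show ?case
    using Suc.IH by (simp only: front_Suc)
qed simp

lemma back_closed [simp]: "x \<in> X (p + q) \<Longrightarrow> back_face p q x \<in> X q"
proof (induction p arbitrary: x)
  case (Suc p)
  then have "face (p + q) p x \<in> X (p + q)"
    by (intro face_closed) auto
  then show ?case
    using Suc.IH by (simp only: back_Suc)
qed simp

lemma face_face_Suc:
  "\<lbrakk>x \<in> X (Suc (Suc n)); i \<le> j; j \<le> Suc n\<rbrakk> \<Longrightarrow>
    face n i (face (Suc n) (Suc j) x) = face n j (face (Suc n) i x)"
  using face_face[of x n i "Suc j"] by simp

text \<open>The next four lemmas compute the front and back faces of the faces \<open>d\<^sub>i x\<close> of a
  \<open>(p + q + 1)\<close>-simplex \<open>x\<close>. A front face reaches one vertex further in \<open>x\<close> if \<open>i\<close> is among its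
  vertices, and a back face starts one vertex later in \<open>x\<close> if \<open>i\<close> lies before it. For
  \<open>i = p + 1\<close> both lemmas on the front face apply, and for \<open>i = p\<close> both lemmas on the back face;
  this overlap is what makes two terms cancel in the Leibniz rule.\<close>

lemma front_face_low:
  assumes "x \<in> X (Suc (p + q))" "i \<le> Suc p"
  shows "front_face p q (face (p + q) i x) = face p i (front_face (Suc p) q x)"
  using assms
proof (induction q arbitrary: x)
  case (Suc q)
  then have x: "x \<in> X (Suc (Suc (p + q)))" by simp
  then have y: "face (Suc (p + q)) (Suc (Suc (p + q))) x \<in> X (Suc (p + q))"
    using face_closed[of x "Suc (p + q)" "Suc (Suc (p + q))"] by simp
  have "front_face p (Suc q) (face (p + Suc q) i x)
      = front_face p q (face (p + q) (Suc (p + q)) (face (Suc (p + q)) i x))"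
    by (simp only: front_Suc add_Suc_right)
  also have "\<dots> = front_face p q (face (p + q) i (face (Suc (p + q)) (Suc (Suc (p + q))) x))"
    using face_face_Suc[OF x, of i "Suc (p + q)"] Suc.prems by simp
  also have "\<dots> = face p i (front_face (Suc p) (Suc q) x)"
    using Suc.IH[OF y Suc.prems(2)] front_Suc[of "Suc p" q x] by simp
  finally show ?case .
qed simp

lemma front_face_high:
  assumes "x \<in> X (Suc (p + q))" "Suc p \<le> i" "i \<le> Suc (p + q)"
  shows "front_face p q (face (p + q) i x) = front_face p (Suc q) x"
  using assms
proof (induction q arbitrary: x)
  case 0
  then have "i = Suc p" by simp
  then show ?case
    using front_Suc[of p 0 x] by simp
next
  case (Suc q)
  show ?case
  proof (cases "i = Suc (Suc (p + q))")
    case True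
    then show ?thesis
      using front_Suc[of p "Suc q" x] by simp
  next
    case False
    have x: "x \<in> X (Suc (Suc (p + q)))"
      using Suc.prems by simp
    then have y: "face (Suc (p + q)) (Suc (Suc (p + q))) x \<in> X (Suc (p + q))"
      using face_closed[of x "Suc (p + q)" "Suc (Suc (p + q))"] by simp
    have "front_face p (Suc q) (face (p + Suc q) i x)
        = front_face p q (face (p + q) (Suc (p + q)) (face (Suc (p + q)) i x))"
      by (simp only: front_Suc add_Suc_right)
    also have "\<dots> = front_face p q (face (p + q) i (face (Suc (p + q)) (Suc (Suc (p + q))) x))"
      using face_face_Suc[OF x, of i "Suc (p + q)"] Suc.prems False by simp
    also have "\<dots> = front_face p (Suc (Suc q)) x"
      using Suc.IH[OF y] Suc.prems False front_Suc[of p "Suc q" x] by simp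
    finally show ?thesis .
  qed
qed

lemma back_face_low:
  assumes "x \<in> X (Suc (p + q))" "i \<le> p"
  shows "back_face p q (face (p + q) i x) = back_face (Suc p) q x"
  using assms
proof (induction p arbitrary: x)
  case 0
  then show ?case
    using back_Suc[of 0 q x] by simp
next
  case (Suc p)
  show ?case
  proof (cases "i = Suc p")
    case True
    then show ?thesis
      using back_Suc[of "Suc p" q x] by simp
  next
    case False
    have x: "x \<in> X (Suc (Suc (p + q)))"
      using Suc.prems by simp
    then have y: "face (Suc (p + q)) (Suc p) x \<in> X (Suc (p + q))"
      using face_closed[of x "Suc (p + q)" "Suc p"] by simp
    have "back_face (Suc p) q (face (Suc p + q) i x)
        = back_face p q (face (p + q) p (face (Suc (p + q)) i x))"
      using back_Suc[of p q "face (Suc p + q) i x"] by simp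
    also have "\<dots> = back_face p q (face (p + q) i (face (Suc (p + q)) (Suc p) x))"
      using face_face_Suc[OF x, of i p] Suc.prems False by simp
    also have "\<dots> = back_face (Suc (Suc p)) q x"
      using Suc.IH[OF y] Suc.prems False back_Suc[of "Suc p" q x] by simp
    finally show ?thesis .
  qed
qed

lemma back_face_high:
  assumes "x \<in> X (Suc (p + q))" "i \<le> Suc q"
  shows "back_face p q (face (p + q) (p + i) x) = face q i (back_face p (Suc q) x)"
  using assms
proof (induction p arbitrary: x)
  case (Suc p)
  have x: "x \<in> X (Suc (Suc (p + q)))"
    using Suc.prems by simp
  then have y: "face (Suc (p + q)) p x \<in> X (Suc (p + q))"
    using face_closed[of x "Suc (p + q)" p] by simp
  have "back_face (Suc p) q (face (Suc p + q) (Suc p + i) x)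
      = back_face p q (face (p + q) p (face (Suc (p + q)) (Suc (p + i)) x))"
    using back_Suc[of p q "face (Suc p + q) (Suc p + i) x"] by simp
  also have "\<dots> = back_face p q (face (p + q) (p + i) (face (Suc (p + q)) p x))"
    using face_face_Suc[OF x, of p "p + i"] Suc.prems by simp
  also have "\<dots> = face q i (back_face (Suc p) (Suc q) x)"
    using Suc.IH[OF y] Suc.prems back_Suc[of p "Suc q" x] by simp
  finally show ?case .
qed simp

lemma front_front: "front_face p q (front_face (p + q) r x) = front_face p (q + r) x"
proof (induction r arbitrary: x)
  case (Suc r)
  then show ?case
    using front_Suc[of "p + q" r x] front_Suc[of p "q + r" x] by (simp add: add.assoc)
qed simp

lemma back_back:
  "x \<in> X (p + q + r) \<Longrightarrow> back_face q r (back_face p (q + r) x) = back_face (p + q) r x"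
proof (induction q arbitrary: x)
  case (Suc q)
  then have x: "x \<in> X (Suc (p + (q + r)))"
    by (simp add: add_ac)
  then have y: "face (p + q + r) (p + q) x \<in> X (p + q + r)"
    using face_closed[of x "p + q + r" "p + q"] by (simp add: add_ac)
  have "back_face (p + Suc q) r x = back_face (p + q) r (face (p + q + r) (p + q) x)"
    using back_Suc[of "p + q" r x] by simp
  also have "\<dots> = back_face q r (back_face p (q + r) (face (p + (q + r)) (p + q) x))"
    using Suc.IH[OF y] by (simp add: add.assoc)
  also have "\<dots> = back_face q r (face (q + r) q (back_face p (Suc (q + r)) x))"
    using back_face_high[OF x, of q] by simp
  also have "\<dots> = back_face (Suc q) r (back_face p (Suc q + r) x)"
    using back_Suc[of q r "back_face p (Suc q + r) x"] by simp
  finally show ?case by simp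
qed simp

lemma front_back:
  "x \<in> X (p + q + r) \<Longrightarrow> front_face q r (back_face p (q + r) x) = back_face p q (front_face (p + q) r x)"
proof (induction r arbitrary: x)
  case (Suc r)
  then have x: "x \<in> X (Suc (p + (q + r)))"
    by (simp add: add_ac)
  then have y: "face (p + q + r) (Suc (p + q + r)) x \<in> X (p + q + r)"
    using face_closed[of x "p + q + r" "Suc (p + q + r)"] by (simp add: add_ac)
  have "front_face q (Suc r) (back_face p (q + Suc r) x)
      = front_face q r (face (q + r) (Suc (q + r)) (back_face p (Suc (q + r)) x))"
    using front_Suc[of q r "back_face p (q + Suc r) x"] by simp
  also have "\<dots> = front_face q r (back_face p (q + r) (face (p + q + r) (Suc (p + q + r)) x))"
    using back_face_high[OF x, of "Suc (q + r)"] by (simp add: add.assoc)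
  also have "\<dots> = back_face p q (front_face (p + q) (Suc r) x)"
    using Suc.IH[OF y] front_Suc[of "p + q" r x] by simp
  finally show ?case .
qed simp

end

section \<open>The differential graded algebra of cochains\<close>

context delta_set
begin

lemma face_closed_Suc [simp]: "\<lbrakk>x \<in> X (Suc n); i \<le> Suc n\<rbrakk> \<Longrightarrow> face n i x \<in> X n"
  using face_closed[of x n i] by simp

lemma keys_boundary:
  assumes "Poly_Mapping.keys c \<subseteq> X (Suc n)"
  shows "Poly_Mapping.keys (boundary face n c) \<subseteq> X n"
proof -
  have "Poly_Mapping.keys (\<Sum>i = 0..n + 1. frag_cmul ((- 1) ^ i) (frag_of (face n i x))) \<subseteq> X n"
    if x: "x \<in> X (Suc n)" for x
  proof -
    have "(\<Sum>i = 0..n + 1. frag_cmul ((- 1) ^ i) (frag_of (face n i x)))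
        \<in> carrier (free_Abelian_group (X n))"
      using x by (intro sum_closed_free_Abelian_group) auto
    then show ?thesis
      by (simp only: carrier_free_Abelian_group_iff)
  qed
  then show ?thesis
    unfolding boundary_def
    by (intro order_trans[OF keys_frag_extend] UN_least) (use assms in auto)
qed

lemma boundary_boundary:
  assumes "Poly_Mapping.keys c \<subseteq> X (Suc (Suc n))"
  shows "boundary face n (boundary face (Suc n) c) = 0"
  using assms
proof (induction rule: frag_induction)
  case (one x)
  let ?f = "\<lambda>(j, i). frag_cmul ((- 1) ^ (j + i)) (frag_of (face n i (face (Suc n) j x)))"
  let ?I = "{0..Suc (Suc n)} \<times> {0..Suc n}"
  let ?L = "{(j, i). i < j \<and> j \<le> Suc (Suc n)}" and ?H = "{(i, j). i \<le> j \<and> j \<le> Suc n}"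
  have L: "?L = (\<lambda>(i, j). (Suc j, i)) ` ?H"
    by (auto simp: image_def less_Suc_eq_le) (metis Suc_le_D Suc_le_eq not_less_eq_eq)
  have fin: "finite ?H"
    by (rule finite_subset[of _ "{0..Suc n} \<times> {0..Suc n}"]) auto
  then have finL: "finite ?L"
    unfolding L by (rule finite_imageI)
  have I: "?I = ?L \<union> ?H"
    by auto
  have "boundary face n (boundary face (Suc n) (frag_of x)) =
      (\<Sum>j = 0..Suc (Suc n). frag_cmul ((- 1) ^ j)
        (\<Sum>i = 0..Suc n. frag_cmul ((- 1) ^ i) (frag_of (face n i (face (Suc n) j x)))))"
    unfolding boundary_def Suc_eq_plus1[symmetric] frag_extend_of
    by (subst frag_extend_sum) (simp_all only: finite_atLeastAtMost o_def frag_extend_cmul frag_extend_of)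
  also have "\<dots> = sum ?f ?I"
    by (simp only: frag_cmul_sum frag_cmul_cmul power_add sum.cartesian_product)
  also have "\<dots> = sum ?f ?L + sum ?f ?H"
    unfolding I by (rule sum.union_disjoint[OF finL fin]) auto
  \<comment> \<open>The face identity matches the term at \<open>(j + 1, i)\<close> with minus the term at \<open>(i, j)\<close>.\<close>
  also have "sum ?f ?L = (\<Sum>p\<in>?H. ?f ((\<lambda>(i, j). (Suc j, i)) p))"
    unfolding L by (subst sum.reindex) (auto simp: inj_on_def)
  also have "\<dots> = (\<Sum>p\<in>?H. - ?f p)"
    using one by (intro sum.cong) (auto simp: face_face_Suc add.commute)
  finally show ?case
    by (simp add: sum_negf)
qed (simp_all add: boundary_def frag_extend_diff)

end

text \<open>A \<open>\<Delta>\<close>-set together with a commutative ring of coefficients for its cochains.\<close>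

locale delta_set_cochains = delta_set X face + cring R
  for R :: "('r, 'k) ring_scheme" (structure)
    and X :: "nat \<Rightarrow> 'x set"
    and face :: "nat \<Rightarrow> nat \<Rightarrow> 'x \<Rightarrow> 'x"
begin

lemma coboundary_closed:
  assumes "u \<in> carrier (cochains R X n)"
  shows "coboundary X face n u \<in> carrier (cochains R X (Suc n))"
  unfolding cochain_iff
proof
  show "coboundary X face n u \<in> hom (free_Abelian_group (X (Suc n))) (add_monoid R)"
    using assms
    by (intro homI) (simp_all add: coboundary_def keys_boundary cochain_closed cochain_add
        keys_add_subset, simp add: boundary_def frag_extend_add cochain_add[OF assms] 
        keys_boundary[unfolded boundary_def, simplified])
qed (simp add: coboundary_def)

lemma coboundary_value:
  assumes "u \<in> carrier (cochains R X n)" "x \<in> X (Suc n)"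
  shows "coboundary X face n u (frag_of x) =
    (\<Oplus>i\<in>{..Suc n}. ((\<ominus> \<one>) [^] i) \<otimes> u (frag_of (face n i x)))"
proof -
  have "coboundary X face n u (frag_of x) =
      u (\<Sum>i\<in>{..Suc n}. frag_cmul ((- 1) ^ i) (frag_of (face n i x)))"
    using assms by (simp add: coboundary_def boundary_def atMost_atLeast0)
  also have "\<dots> = (\<Oplus>i\<in>{..Suc n}. u (frag_cmul ((- 1) ^ i) (frag_of (face n i x))))"
    using assms by (intro cochain_sum[where X = X and n = n]) auto
  also have "\<dots> = (\<Oplus>i\<in>{..Suc n}. ((\<ominus> \<one>) [^] i) \<otimes> u (frag_of (face n i x)))"
    using assms by (intro finsum_cong') (auto simp: cochain_sign[where X = X and n = n])
  finally show ?thesis .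
qed

lemma linear_coboundary: "linear_map R (cochains R X n) (cochains R X (Suc n)) (coboundary X face n)"
proof -
  have "coboundary X face n (u \<oplus>\<^bsub>cochains R X n\<^esub> v) =
      coboundary X face n u \<oplus>\<^bsub>cochains R X (Suc n)\<^esub> coboundary X face n v" for u v
    by (rule ext) (simp add: coboundary_def cochains_def Let_def keys_boundary)
  moreover have "coboundary X face n (r \<odot>\<^bsub>cochains R X n\<^esub> u) =
      r \<odot>\<^bsub>cochains R X (Suc n)\<^esub> coboundary X face n u" for r u
    by (rule ext) (simp add: coboundary_def cochains_def Let_def keys_boundary)
  ultimately show ?thesis
    by (simp add: linear_map_def coboundary_closed)
qed

lemma coboundary_coboundary:
  assumes "u \<in> carrier (cochains R X n)"
  shows "coboundary X face (Suc n) (coboundary X face n u) = \<zero>\<^bsub>cochains R X (Suc (Suc n))\<^esub>"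
  using assms
  by (intro ext) (simp add: coboundary_def cochains_def Let_def keys_boundary boundary_boundary
      cochain_0[OF assms])

lemma cup_value:
  assumes "u \<in> carrier (cochains R X p)" "v \<in> carrier (cochains R X q)" "x \<in> X (p + q)"
  shows "cup_product R X face p q u v (frag_of x) =
    u (frag_of (front_face p q x)) \<otimes> v (frag_of (back_face p q x))"
  using assms
  by (simp add: cup_product_def flip: front_face_def back_face_def)

lemma cup_closed:
  assumes "u \<in> carrier (cochains R X p)" "v \<in> carrier (cochains R X q)"
  shows "cup_product R X face p q u v \<in> carrier (cochains R X (p + q))"
  unfolding cup_product_def using assms
  by (intro cochain_of_closed) (simp flip: front_face_def back_face_def)

lemma bilinear_cup:
  "bilinear_map R (cochains R X p) (cochains R X q) (cochains R X (p + q))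
    (cup_product R X face p q)"
  unfolding bilinear_map_def linear_map_def
  by (auto intro!: cochain_eqI[where X = X and n = "p + q"]
      simp: cup_closed cochains_add_closed cochains_smult_closed cup_value l_distr r_distr
        m_assoc m_lcomm)

lemma cup_assoc:
  assumes "u \<in> carrier (cochains R X p)" "v \<in> carrier (cochains R X q)"
    "w \<in> carrier (cochains R X r)"
  shows "cup_product R X face (p + q) r (cup_product R X face p q u v) w =
    cup_product R X face p (q + r) u (cup_product R X face q r v w)"
proof (rule cochain_eqI)
  show "cup_product R X face (p + q) r (cup_product R X face p q u v) w
      \<in> carrier (cochains R X (p + q + r))"
    using assms by (simp add: cup_closed)
  show "cup_product R X face p (q + r) u (cup_product R X face q r v w)
      \<in> carrier (cochains R X (p + q + r))"
    using assms cup_closed[of u p "cup_product R X face q r v w" "q + r"]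
    by (simp add: cup_closed add.assoc)
next
  fix x assume x: "x \<in> X (p + q + r)"
  then have x': "x \<in> X (p + (q + r))"
    by (simp add: add.assoc)
  have "front_face p (q + r) x \<in> X p" "front_face q r (back_face p (q + r) x) \<in> X q"
    "back_face (p + q) r x \<in> X r"
    using x x' by simp_all
  then show "cup_product R X face (p + q) r (cup_product R X face p q u v) w (frag_of x) =
      cup_product R X face p (q + r) u (cup_product R X face q r v w) (frag_of x)"
    using assms x x'
    by (simp add: cup_value cup_closed front_front back_back flip: front_back)
      (simp add: m_assoc)
qed

lemma unit_closed: "unit_cochain R X \<in> carrier (cochains R X 0)"
  unfolding unit_cochain_def by (rule cochain_of_closed) simp

lemma unit_value [simp]: "x \<in> X 0 \<Longrightarrow> unit_cochain R X (frag_of x) = \<one>"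
  by (simp add: unit_cochain_def)

lemma cup_unit:
  assumes "u \<in> carrier (cochains R X p)"
  shows "cup_product R X face 0 p (unit_cochain R X) u = u"
    and "cup_product R X face p 0 u (unit_cochain R X) = u"
  using assms unit_closed cup_closed[of "unit_cochain R X" 0 u p]
    cup_closed[of u p "unit_cochain R X" 0] front_closed[of _ 0 p] back_closed[of _ p 0]
  by (auto intro!: cochain_eqI[where X = X and n = p]
      simp: cup_value[where p = 0, simplified] cup_value[where q = 0, simplified])

text \<open>The front \<open>0\<close>-face of any simplex is a vertex.\<close>

lemma vertices_nonempty:
  assumes "X n \<noteq> {}"
  shows "X 0 \<noteq> {}"
proof -
  obtain x where "x \<in> X (0 + n)"
    using assms by auto
  then have "front_face 0 n x \<in> X 0"
    by (rule front_closed)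
  then show ?thesis
    by blast
qed

text \<open>On the right-hand side, the last term of \<open>du \<union> v\<close> and the first term of \<open>(-1)\<^sup>p u \<union> dv\<close>
  cancel; the remaining ones are the terms of \<open>d (u \<union> v)\<close> for the faces opposite to a vertex
  \<open>\<le> p\<close> and \<open>> p\<close>, respectively.\<close>

lemma coboundary_cup:
  assumes u: "u \<in> carrier (cochains R X p)" and v: "v \<in> carrier (cochains R X q)"
  shows "coboundary X face (p + q) (cup_product R X face p q u v) =
    cup_product R X face (Suc p) q (coboundary X face p u) v
      \<oplus>\<^bsub>cochains R X (Suc (p + q))\<^esub>
    ((\<ominus> \<one>) [^] p) \<odot>\<^bsub>cochains R X (Suc (p + q))\<^esub>
      cup_product R X face p (Suc q) u (coboundary X face q v)"
    (is "?l = ?a \<oplus>\<^bsub>_\<^esub> _ \<odot>\<^bsub>_\<^esub> ?b")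
proof (rule cochain_eqI)
  let ?C = "cochains R X (Suc (p + q))"
  have a: "?a \<in> carrier ?C" and b: "?b \<in> carrier ?C"
    using cup_closed[OF coboundary_closed[OF u] v] cup_closed[OF u coboundary_closed[OF v]]
    by simp_all
  show "?l \<in> carrier ?C"
    using u v by (intro coboundary_closed cup_closed)
  show "?a \<oplus>\<^bsub>?C\<^esub> ((\<ominus> \<one>) [^] p) \<odot>\<^bsub>?C\<^esub> ?b \<in> carrier ?C"
    using a b by (simp add: cochains_add_closed cochains_smult_closed)
  fix x assume x: "x \<in> X (Suc (p + q))"
  define s where "s i = (\<ominus> \<one>) [^] i" for i :: nat
  define F where "F = front_face (Suc p) q x"
  define B where "B = back_face p (Suc q) x"
  have s: "s i \<in> carrier R" and s_Suc: "s (Suc i) = \<ominus> s i" and s_add: "s (i + j) = s i \<otimes> s j"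
    for i j
    by (simp_all add: s_def r_minus nat_pow_mult)
  have F: "F \<in> X (Suc p)" and B: "B \<in> X (Suc q)"
    using x by (simp_all add: F_def B_def)
  have F0: "face p (Suc p) F = front_face p (Suc q) x"
    using front_face_low[OF x, of "Suc p"] front_face_high[OF x, of "Suc p"] by (simp add: F_def)
  have B0: "face q 0 B = back_face (Suc p) q x"
    using back_face_low[OF x, of p] back_face_high[OF x, of 0] by (simp add: B_def)
  define \<alpha> where "\<alpha> i = u (frag_of (face p i F))" for i
  define \<beta> where "\<beta> i = v (frag_of (face q i B))" for i
  have \<alpha>: "\<alpha> i \<in> carrier R" if "i \<le> Suc p" for i
    using that u F by (simp add: \<alpha>_def)
  have \<beta>: "\<beta> i \<in> carrier R" if "i \<le> Suc q" for i
    using that v B by (simp add: \<beta>_def)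
  define S where "S = (\<Oplus>i\<in>{..p}. s i \<otimes> \<alpha> i)"
  define T where "T = (\<Oplus>i\<in>{..q}. s (Suc i) \<otimes> \<beta> (Suc i))"
  have ST: "S \<in> carrier R" "T \<in> carrier R"
    unfolding S_def T_def using s \<alpha> \<beta> by (auto intro!: finsum_closed)
  have "?a (frag_of x) = coboundary X face p u (frag_of F) \<otimes> \<beta> 0"
    using cup_value[OF coboundary_closed[OF u] v, of x] x by (simp add: F_def \<beta>_def B0)
  also have "coboundary X face p u (frag_of F) = s (Suc p) \<otimes> \<alpha> (Suc p) \<oplus> S"
    unfolding coboundary_value[OF u F] S_def s_def[symmetric] \<alpha>_def[symmetric]
    using s \<alpha> by (subst finsum_Suc) auto
  finally have a_val: "?a (frag_of x) = (s (Suc p) \<otimes> \<alpha> (Suc p) \<oplus> S) \<otimes> \<beta> 0" .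
  have "?b (frag_of x) = \<alpha> (Suc p) \<otimes> coboundary X face q v (frag_of B)"
    using cup_value[OF u coboundary_closed[OF v], of x] x by (simp add: B_def \<alpha>_def F0)
  also have "coboundary X face q v (frag_of B) = T \<oplus> \<beta> 0"
    unfolding coboundary_value[OF v B] T_def s_def[symmetric] \<beta>_def[symmetric]
    using s \<beta> by (subst finsum_Suc2) (auto simp: s_def)
  finally have b_val: "?b (frag_of x) = \<alpha> (Suc p) \<otimes> (T \<oplus> \<beta> 0)" .
  define g where "g = (\<lambda>i. s i \<otimes> cup_product R X face p q u v (frag_of (face (p + q) i x)))"
  have g: "g i \<in> carrier R" if "i \<le> Suc (p + q)" for i
    using that x s cup_closed[OF u v] by (simp add: g_def)
  have "?l (frag_of x) = finsum R g {..Suc (p + q)}"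
    using coboundary_value[OF cup_closed[OF u v] x] by (simp only: g_def s_def)
  also have "\<dots> = finsum R g {..p} \<oplus> (\<Oplus>i\<in>{..q}. g (Suc p + i))"
    using g by (intro finsum_split) auto
  also have "finsum R g {..p} = (\<Oplus>i\<in>{..p}. (s i \<otimes> \<alpha> i) \<otimes> \<beta> 0)"
  proof (rule finsum_cong')
    fix i assume "i \<in> {..p}"
    then have "i \<le> Suc p" "g i = s i \<otimes> (\<alpha> i \<otimes> \<beta> 0)"
      using x front_face_low[OF x, of i] back_face_low[OF x, of i]
      by (simp_all add: g_def cup_value[OF u v] \<alpha>_def \<beta>_def B0 F_def)
    then show "g i = (s i \<otimes> \<alpha> i) \<otimes> \<beta> 0"
      using s[of i] \<alpha>[of i] \<beta>[of 0] by (simp add: m_assoc)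
  qed (use s \<alpha> \<beta> in auto)
  also have "\<dots> = S \<otimes> \<beta> 0"
    unfolding S_def using s \<alpha> \<beta> by (subst finsum_ldistr) auto
  also have "(\<Oplus>i\<in>{..q}. g (Suc p + i)) =
      (\<Oplus>i\<in>{..q}. (s p \<otimes> \<alpha> (Suc p)) \<otimes> (s (Suc i) \<otimes> \<beta> (Suc i)))"
  proof (rule finsum_cong')
    fix i assume i: "i \<in> {..q}"
    have "g (Suc p + i) = s (p + Suc i) \<otimes> (\<alpha> (Suc p) \<otimes> \<beta> (Suc i))"
      using x i front_face_high[OF x, of "Suc p + i"] back_face_high[OF x, of "Suc i"]
      by (simp add: g_def cup_value[OF u v] \<alpha>_def \<beta>_def F0 B_def)
    then show "g (Suc p + i) = (s p \<otimes> \<alpha> (Suc p)) \<otimes> (s (Suc i) \<otimes> \<beta> (Suc i))"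
      using i s \<alpha> \<beta> by (simp only: s_add) (simp add: m_ac)
  qed (use s \<alpha> \<beta> in auto)
  also have "\<dots> = (s p \<otimes> \<alpha> (Suc p)) \<otimes> T"
    unfolding T_def using s \<alpha> \<beta> by (subst finsum_rdistr) auto
  also have "S \<otimes> \<beta> 0 \<oplus> (s p \<otimes> \<alpha> (Suc p)) \<otimes> T =
      (s (Suc p) \<otimes> \<alpha> (Suc p) \<oplus> S) \<otimes> \<beta> 0 \<oplus> s p \<otimes> (\<alpha> (Suc p) \<otimes> (T \<oplus> \<beta> 0))"
    unfolding s_Suc using s[of p] \<alpha>[of "Suc p"] \<beta>[of 0] ST by simp algebra
  finally show "?l (frag_of x) = (?a \<oplus>\<^bsub>?C\<^esub> ((\<ominus> \<one>) [^] p) \<odot>\<^bsub>?C\<^esub> ?b) (frag_of x)"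
    using x by (simp add: a_val b_val s_def)
qed

end

section \<open>Spans and restrictions of bilinear maps\<close>

lemma module_span_subset: "\<lbrakk>submodule H R M; S \<subseteq> H\<rbrakk> \<Longrightarrow> module_span R M S \<subseteq> H"
  by (auto simp: module_span_def)

lemma module_span_superset: "S \<subseteq> module_span R M S"
  by (auto simp: module_span_def)

lemma (in module) submodule_carrier: "submodule (carrier M) R M"
  by (rule submoduleI) auto

lemma (in module) submodule_zero: "submodule H R M \<Longrightarrow> \<zero>\<^bsub>M\<^esub> \<in> H"
  using subgroup.one_closed[OF submodule.axioms(1)] by fastforce

lemma (in module) submodule_module_span:
  assumes "S \<subseteq> carrier M"
  shows "submodule (module_span R M S) R M"
proof (rule submoduleI)
  show "module_span R M S \<subseteq> carrier M"
    using submodule_carrier assms by (rule module_span_subset)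
qed (auto simp: module_span_def submodule_zero dest: submoduleE)

lemma bilinear_map_restrict:
  assumes "bilinear_map R M M M f" "D \<subseteq> carrier M" "\<And>x y. \<lbrakk>x \<in> D; y \<in> D\<rbrakk> \<Longrightarrow> f x y \<in> D"
  shows "bilinear_map R (M\<lparr>carrier := D\<rparr>) (M\<lparr>carrier := D\<rparr>) (M\<lparr>carrier := D\<rparr>) f"
proof -
  have "x \<in> carrier M" if "x \<in> D" for x
    using that assms(2) by blast
  then show ?thesis
    using assms(1,3) by (simp add: bilinear_map_def linear_map_def Pi_iff)
qed

section \<open>Cup-one products of cochains\<close>

context delta_set
begin

text \<open>Since the list is strictly decreasing, each entry is at most the dimension of the simplex
  that is left when it is deleted.\<close>

lemma delete_vertices_closed:
  "\<lbrakk>x \<in> X n; sorted_wrt (>) is; \<forall>i\<in>set is. i \<le> n; length is \<le> n\<rbrakk> \<Longrightarrow>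
    delete_vertices face is n x \<in> X (n - length is)"
proof (induction "is" arbitrary: n x)
  case (Cons i "is")
  then obtain m where m: "n = Suc m"
    by (cases n) auto
  have "face m i x \<in> X m" "\<forall>j\<in>set is. j \<le> m"
    using Cons.prems m by auto
  then show ?case
    using Cons m by simp
qed simp

lemma subface_closed:
  assumes "x \<in> X n" "V \<subseteq> {0..n}" "V \<noteq> {}"
  shows "subface face n V x \<in> X (card V - 1)"
proof -
  let ?is = "rev (sorted_list_of_set ({0..n} - V))"
  have V: "finite V" "card V \<le> Suc n" "card V > 0"
    using assms card_mono[of "{0..n}" V] finite_subset[of V] by (auto simp: card_gt_0_iff)
  then have len: "length ?is = Suc n - card V"
    using assms by (simp add: card_Diff_subset)
  have "delete_vertices face ?is n x \<in> X (n - length ?is)"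
    using assms V len
    by (intro delete_vertices_closed) (auto simp: sorted_wrt_rev simp flip: strict_sorted_iff)
  moreover have "n - length ?is = card V - 1"
    using V len by simp
  ultimately show ?thesis
    by (simp add: subface_def)
qed

end

context delta_set_cochains
begin

text \<open>The pointwise product of two \<open>n\<close>-cochains. In degree \<open>1\<close> it is the cup-one product, and
  in degree \<open>2\<close> it restricts to the operation \<open>\<circ>\<close> on sums of decomposable elements.\<close>

definition pointwise_product ::
  "nat \<Rightarrow> (('x \<Rightarrow>\<^sub>0 int) \<Rightarrow> 'r) \<Rightarrow> (('x \<Rightarrow>\<^sub>0 int) \<Rightarrow> 'r) \<Rightarrow> (('x \<Rightarrow>\<^sub>0 int) \<Rightarrow> 'r)"
  where "pointwise_product n u v = cochain_of R (X n) (\<lambda>x. u (frag_of x) \<otimes> v (frag_of x))"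

lemma pointwise_product_closed [simp]:
  "\<lbrakk>u \<in> carrier (cochains R X n); v \<in> carrier (cochains R X n)\<rbrakk> \<Longrightarrow>
    pointwise_product n u v \<in> carrier (cochains R X n)"
  unfolding pointwise_product_def by (rule cochain_of_closed) simp

lemma pointwise_product_value [simp]:
  "\<lbrakk>u \<in> carrier (cochains R X n); v \<in> carrier (cochains R X n); x \<in> X n\<rbrakk> \<Longrightarrow>
    pointwise_product n u v (frag_of x) = u (frag_of x) \<otimes> v (frag_of x)"
  by (simp add: pointwise_product_def)

lemma bilinear_pointwise_product:
  "bilinear_map R (cochains R X n) (cochains R X n) (cochains R X n) (pointwise_product n)"
  unfolding bilinear_map_def linear_map_def
  by (auto intro!: cochain_eqI[where X = X and n = n]
      simp: cochains_add_closed cochains_smult_closed l_distr r_distr m_assoc m_lcomm)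

lemma pointwise_product_commute:
  assumes "u \<in> carrier (cochains R X n)" "v \<in> carrier (cochains R X n)"
  shows "pointwise_product n u v = pointwise_product n v u"
  using assms by (intro cochain_eqI[where X = X and n = n]) (simp_all add: m_comm)

lemma front_1_1_closed [simp]: "x \<in> X 2 \<Longrightarrow> front_face 1 1 x \<in> X 1"
  and back_1_1_closed [simp]: "x \<in> X 2 \<Longrightarrow> back_face 1 1 x \<in> X 1"
  using front_closed[of x 1 1] back_closed[of x 1 1] by (simp_all add: numeral_2_eq_2)

lemma cup_1_1_closed [simp]:
  "\<lbrakk>u \<in> carrier (cochains R X 1); v \<in> carrier (cochains R X 1)\<rbrakk> \<Longrightarrow>
    cup_product R X face 1 1 u v \<in> carrier (cochains R X 2)"
  using cup_closed[of u 1 v 1] by (simp add: numeral_2_eq_2)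

lemma cup_1_1_value [simp]:
  "\<lbrakk>u \<in> carrier (cochains R X 1); v \<in> carrier (cochains R X 1); x \<in> X 2\<rbrakk> \<Longrightarrow>
    cup_product R X face 1 1 u v (frag_of x) =
      u (frag_of (front_face 1 1 x)) \<otimes> v (frag_of (back_face 1 1 x))"
  using cup_value[of u 1 v 1 x] by (simp add: numeral_2_eq_2)

lemma edge_closed:
  assumes "x \<in> X p" "j < p"
  shows "subface face p {j..j + 1} x \<in> X 1"
  using assms subface_closed[of x p "{j..j + 1}"] by simp

text \<open>The sign in Steenrod's formula is \<open>1\<close> for a right factor of degree \<open>1\<close>, and the left
  factor is evaluated on the whole simplex.\<close>

lemma cup1_summands:
  assumes "u \<in> carrier (cochains R X p)" "v \<in> carrier (cochains R X 1)" "x \<in> X p"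
  shows "(\<Oplus>j\<in>{..<p}. ((\<ominus> \<one>) [^] ((p - j) * (1 + 1))) \<otimes>
      (u (frag_of (subface face (p + 1 - 1) ({0..j} \<union> {j + 1..p + 1 - 1}) x))
        \<otimes> v (frag_of (subface face (p + 1 - 1) {j..j + 1} x)))) =
    u (frag_of x) \<otimes> (\<Oplus>j\<in>{..<p}. v (frag_of (subface face p {j..j + 1} x)))"
proof -
  note edge = edge_closed[OF assms(3)]
  have whole: "subface face p ({0..j} \<union> {j + 1..p}) x = x" for j
  proof -
    have "{0..p} - ({0..j} \<union> {j + 1..p}) = {}"
      by auto
    then show ?thesis
      by (simp only: subface_def sorted_list_of_set_empty rev.simps delete_vertices.simps)
  qed
  have "(\<Oplus>j\<in>{..<p}. ((\<ominus> \<one>) [^] ((p - j) * (1 + 1))) \<otimes>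
      (u (frag_of (subface face (p + 1 - 1) ({0..j} \<union> {j + 1..p + 1 - 1}) x))
        \<otimes> v (frag_of (subface face (p + 1 - 1) {j..j + 1} x)))) =
    (\<Oplus>j\<in>{..<p}. u (frag_of x) \<otimes> v (frag_of (subface face p {j..j + 1} x)))"
    unfolding add_diff_cancel_right' whole even_sign
    using assms edge by (intro finsum_cong') (auto simp del: One_nat_def)
  then show ?thesis
    using assms edge by (subst finsum_rdistr) (auto simp del: One_nat_def)
qed

lemma edge_sum_closed:
  assumes "v \<in> carrier (cochains R X 1)" "x \<in> X p"
  shows "(\<Oplus>j\<in>{..<p}. v (frag_of (subface face p {j..j + 1} x))) \<in> carrier R"
  using assms edge_closed by (intro finsum_closed) (auto simp del: One_nat_def)

lemma cup1_closed:
  assumes "u \<in> carrier (cochains R X p)" "v \<in> carrier (cochains R X 1)"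
  shows "steenrod_cup1 R X face p 1 u v \<in> carrier (cochains R X p)"
  unfolding steenrod_cup1_def add_diff_cancel_right'[of p 1]
proof (rule cochain_of_closed)
  fix x assume x: "x \<in> X p"
  then have "u (frag_of x) \<otimes> (\<Oplus>j\<in>{..<p}. v (frag_of (subface face p {j..j + 1} x))) \<in> carrier R"
    using assms by (intro m_closed edge_sum_closed) auto
  then show "(\<Oplus>j\<in>{..<p}. ((\<ominus> \<one>) [^] ((p - j) * (1 + 1))) \<otimes>
      (u (frag_of (subface face p ({0..j} \<union> {j + 1..p}) x))
        \<otimes> v (frag_of (subface face p {j..j + 1} x)))) \<in> carrier R"
    using cup1_summands[OF assms x] by (simp only: add_diff_cancel_right')
qed

lemma cup1_value:
  assumes "u \<in> carrier (cochains R X p)" "v \<in> carrier (cochains R X 1)" "x \<in> X p"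
  shows "steenrod_cup1 R X face p 1 u v (frag_of x) =
    u (frag_of x) \<otimes> (\<Oplus>j\<in>{..<p}. v (frag_of (subface face p {j..j + 1} x)))"
  unfolding steenrod_cup1_def
  using assms cup1_summands[OF assms] edge_sum_closed[OF assms(2,3)]
  by (subst cochain_of_value) (simp_all only: add_diff_cancel_right' m_closed cochain_value_closed)

lemma cup1_1_eq:
  assumes "u \<in> carrier (cochains R X 1)" "v \<in> carrier (cochains R X 1)"
  shows "steenrod_cup1 R X face 1 1 u v = pointwise_product 1 u v"
proof (rule cochain_eqI)
  fix x assume x: "x \<in> X 1"
  have "subface face 1 {0..0 + 1} x = x"
    by (simp add: subface_def)
  moreover have "{..<1::nat} = {0}"
    by auto
  ultimately show "steenrod_cup1 R X face 1 1 u v (frag_of x) = pointwise_product 1 u v (frag_of x)"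
    using assms x by (simp add: cup1_value del: One_nat_def)
qed (use assms in \<open>simp_all add: cup1_closed del: One_nat_def\<close>)

lemma cup1_2_value:
  assumes "u \<in> carrier (cochains R X 2)" "v \<in> carrier (cochains R X 1)" "x \<in> X 2"
  shows "steenrod_cup1 R X face 2 1 u v (frag_of x) =
    u (frag_of x) \<otimes> (v (frag_of (front_face 1 1 x)) \<oplus> v (frag_of (back_face 1 1 x)))"
proof -
  have "subface face 2 {0..0 + 1} x = front_face 1 1 x"
    "subface face 2 {1..1 + 1} x = back_face 1 1 x"
    by (simp_all add: front_face_def back_face_def numeral_2_eq_2)
  moreover have "{..<2::nat} = {0, 1}"
    by auto
  ultimately show ?thesis
    unfolding cup1_value[OF assms] using assms by (simp del: One_nat_def)
qed

lemma bilinear_cup1: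
  "bilinear_map R (cochains R X p) (cochains R X 1) (cochains R X p) (steenrod_cup1 R X face p 1)"
proof -
  have closed: "(\<lambda>j. v (frag_of (subface face p {j..j + 1} x))) \<in> {..<p} \<rightarrow> carrier R"
    if "v \<in> carrier (cochains R X 1)" "x \<in> X p" for v x
    using that edge_closed by (auto simp del: One_nat_def)
  have add: "(\<Oplus>j\<in>{..<p}. (v \<oplus>\<^bsub>cochains R X 1\<^esub> w) (frag_of (subface face p {j..j + 1} x))) =
      (\<Oplus>j\<in>{..<p}. v (frag_of (subface face p {j..j + 1} x))) \<oplus>
      (\<Oplus>j\<in>{..<p}. w (frag_of (subface face p {j..j + 1} x)))"
    if "v \<in> carrier (cochains R X 1)" "w \<in> carrier (cochains R X 1)" "x \<in> X p" for v w x
    unfolding finsum_addf[OF closed[OF that(1,3)] closed[OF that(2,3)], symmetric]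
    using that edge_closed by (intro finsum_cong') (auto simp del: One_nat_def)
  have smult: "(\<Oplus>j\<in>{..<p}. (r \<odot>\<^bsub>cochains R X 1\<^esub> v) (frag_of (subface face p {j..j + 1} x))) =
      r \<otimes> (\<Oplus>j\<in>{..<p}. v (frag_of (subface face p {j..j + 1} x)))"
    if "v \<in> carrier (cochains R X 1)" "r \<in> carrier R" "x \<in> X p" for v r x
    unfolding finsum_rdistr[OF finite_lessThan that(2) closed[OF that(1,3)]]
    using that edge_closed by (intro finsum_cong') (auto simp del: One_nat_def)
  show ?thesis
    unfolding bilinear_map_def linear_map_def
    by (auto intro!: cochain_eqI[where X = X and n = p]
        simp: cup1_closed cup1_value cochains_add_closed cochains_smult_closed add
          smult edge_sum_closed l_distr r_distr m_assoc m_lcomm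
        simp del: One_nat_def)
qed

lemma cup1_hirsch:
  assumes "a \<in> carrier (cochains R X 1)" "b \<in> carrier (cochains R X 1)"
    "c \<in> carrier (cochains R X 1)"
  shows "steenrod_cup1 R X face 2 1 (cup_product R X face 1 1 a b) c =
    cup_product R X face 1 1 a (steenrod_cup1 R X face 1 1 b c) \<oplus>\<^bsub>cochains R X 2\<^esub>
    cup_product R X face 1 1 (steenrod_cup1 R X face 1 1 a c) b"
  using assms
  by (intro cochain_eqI[where X = X and n = 2])
    (simp_all add: cup1_1_eq cup1_closed cup1_2_value cochains_add_closed r_distr m_ac a_ac
      del: One_nat_def)

lemma cring_adjoin_scalars_cup1:
  "cring (adjoin_scalars R (cochains R X 1) (steenrod_cup1 R X face 1 1))"
    (is "cring ?A")
proof -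
  interpret M: module R "cochains R X 1"
    by (rule module_cochains)
  have closed: "u \<oplus>\<^bsub>cochains R X 1\<^esub> v \<in> carrier (cochains R X 1)"
    "r \<odot>\<^bsub>cochains R X 1\<^esub> u \<in> carrier (cochains R X 1)"
    if "u \<in> carrier (cochains R X 1)" "v \<in> carrier (cochains R X 1)" "r \<in> carrier R" for u v r
    using that by (simp_all del: One_nat_def)
  show ?thesis
  proof (rule cringI)
    show "abelian_group ?A"
    proof (rule abelian_groupI)
      fix z assume z: "z \<in> carrier ?A"
      show "\<exists>y\<in>carrier ?A. y \<oplus>\<^bsub>?A\<^esub> z = \<zero>\<^bsub>?A\<^esub>"
        using z by (intro bexI[of _ "(\<ominus> fst z, \<ominus>\<^bsub>cochains R X 1\<^esub> snd z)"])
          (auto simp: adjoin_scalars_def l_neg M.l_neg simp del: One_nat_def)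
    qed (auto simp: adjoin_scalars_def a_ac M.a_ac simp del: One_nat_def)
  next
    show "comm_monoid ?A"
      by (rule comm_monoidI)
        (auto simp: adjoin_scalars_def cup1_1_eq closed m_ac l_distr r_distr a_ac
          intro!: cochain_eqI[where X = X and n = 1] simp del: One_nat_def)
  next
    fix x y z assume "x \<in> carrier ?A" "y \<in> carrier ?A" "z \<in> carrier ?A"
    then show "(x \<oplus>\<^bsub>?A\<^esub> y) \<otimes>\<^bsub>?A\<^esub> z = x \<otimes>\<^bsub>?A\<^esub> z \<oplus>\<^bsub>?A\<^esub> y \<otimes>\<^bsub>?A\<^esub> z"
      by (auto simp: adjoin_scalars_def cup1_1_eq closed l_distr r_distr a_ac
          intro!: cochain_eqI[where X = X and n = 1] simp del: One_nat_def)
  qed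
qed

lemma submodule_decomposables:
  "submodule (decomposables R (cochains R X) (cup_product R X face)) R (cochains R X 2)"
  unfolding decomposables_def
  by (rule module.submodule_module_span[OF module_cochains]) (auto simp del: One_nat_def)

lemma cup_decomposable:
  "\<lbrakk>u \<in> carrier (cochains R X 1); v \<in> carrier (cochains R X 1)\<rbrakk> \<Longrightarrow>
    cup_product R X face 1 1 u v \<in> decomposables R (cochains R X) (cup_product R X face)"
  unfolding decomposables_def by (rule subsetD[OF module_span_superset]) blast

lemma pointwise_product_cup:
  assumes "u \<in> carrier (cochains R X 1)" "v \<in> carrier (cochains R X 1)"
    "w \<in> carrier (cochains R X 1)" "z \<in> carrier (cochains R X 1)"
  shows "pointwise_product 2 (cup_product R X face 1 1 u v) (cup_product R X face 1 1 w z) =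
    cup_product R X face 1 1 (steenrod_cup1 R X face 1 1 u w) (steenrod_cup1 R X face 1 1 v z)"
  using assms
  by (intro cochain_eqI[where X = X and n = 2]) (simp_all add: cup1_1_eq m_ac del: One_nat_def)

lemma submodule_pointwise_vimage:
  assumes H: "submodule H R (cochains R X n)" and v: "v \<in> carrier (cochains R X n)"
  shows "submodule {u \<in> carrier (cochains R X n). pointwise_product n u v \<in> H} R (cochains R X n)"
proof -
  interpret M: module R "cochains R X n"
    by (rule module_cochains)
  note H = M.submoduleE[OF H]
  have lin: "linear_map R (cochains R X n) (cochains R X n) (\<lambda>u. pointwise_product n u v)"
    using bilinear_pointwise_product v by (simp add: bilinear_map_def)
  have zero: "pointwise_product n \<zero>\<^bsub>cochains R X n\<^esub> v = \<zero>\<^bsub>cochains R X n\<^esub>"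
    using v by (intro cochain_eqI[where X = X and n = n]) auto
  have neg: "pointwise_product n (\<ominus>\<^bsub>cochains R X n\<^esub> u) v = \<ominus>\<^bsub>cochains R X n\<^esub> pointwise_product n u v"
    if "u \<in> carrier (cochains R X n)" for u
    using v that
    by (intro cochain_eqI[where X = X and n = n]) (auto simp: cochains_neg_value l_minus)
  have "\<zero>\<^bsub>cochains R X n\<^esub> \<in> H"
    using assms(1) by (rule M.submodule_zero)
  with lin H zero neg show ?thesis
    by (intro M.submoduleI) (auto simp: linear_map_def)
qed

text \<open>By linearity in one factor at a time it suffices to multiply generators, where
  \<open>(u \<union> v) \<circ> (w \<union> z) = (u \<union>\<^sub>1 w) \<union> (v \<union>\<^sub>1 z)\<close> is again decomposable.\<close>

lemma pointwise_product_decomposables: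
  assumes s: "s \<in> decomposables R (cochains R X) (cup_product R X face)" (is "_ \<in> ?D")
    and t: "t \<in> decomposables R (cochains R X) (cup_product R X face)"
  shows "pointwise_product 2 s t \<in> ?D"
proof -
  note D = submodule_decomposables
  have sub: "?D \<subseteq> carrier (cochains R X 2)"
    using D by (rule module.submoduleE(1)[OF module_cochains])
  have span: "?D \<subseteq> {u \<in> carrier (cochains R X 2). pointwise_product 2 u v \<in> ?D}"
    if "v \<in> carrier (cochains R X 2)"
      and "\<And>a b. \<lbrakk>a \<in> carrier (cochains R X 1); b \<in> carrier (cochains R X 1)\<rbrakk> \<Longrightarrow>
        pointwise_product 2 (cup_product R X face 1 1 a b) v \<in> ?D" for v
  proof -
    have "module_span R (cochains R X 2)
        {cup_product R X face 1 1 a b |a b.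
          a \<in> carrier (cochains R X 1) \<and> b \<in> carrier (cochains R X 1)}
      \<subseteq> {u \<in> carrier (cochains R X 2). pointwise_product 2 u v \<in> ?D}"
      using submodule_pointwise_vimage[OF D that(1)] that(2)
      by (intro module_span_subset) (auto simp del: One_nat_def)
    then show ?thesis
      by (simp only: decomposables_def)
  qed
  have gen: "pointwise_product 2 s (cup_product R X face 1 1 a b) \<in> ?D"
    if "s \<in> ?D" "a \<in> carrier (cochains R X 1)" "b \<in> carrier (cochains R X 1)" for s a b
    using span[of "cup_product R X face 1 1 a b"] that
    by (auto simp: pointwise_product_cup cup1_1_eq cup_decomposable simp del: One_nat_def)
  have "pointwise_product 2 (cup_product R X face 1 1 a b) t \<in> ?D"
    if "a \<in> carrier (cochains R X 1)" "b \<in> carrier (cochains R X 1)" for a b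
    using gen[OF t that] pointwise_product_commute[of t 2 "cup_product R X face 1 1 a b"] sub t that
    by (auto simp del: One_nat_def)
  then show ?thesis
    using span[of t] s t sub by blast
qed

lemma coboundary_1_closed:
  "u \<in> carrier (cochains R X 1) \<Longrightarrow> coboundary X face 1 u \<in> carrier (cochains R X 2)"
  using coboundary_closed[of u 1] by (simp add: numeral_2_eq_2)

lemma coboundary_1_value:
  assumes "u \<in> carrier (cochains R X 1)" "x \<in> X 2"
  shows "coboundary X face 1 u (frag_of x) =
    u (frag_of (front_face 1 1 x)) \<oplus> u (frag_of (back_face 1 1 x)) \<ominus> u (frag_of (face 1 1 x))"
proof -
  have x: "x \<in> X (Suc 1)" using assms by (simp add: numeral_2_eq_2)
  have f: "back_face 1 1 x = face 1 0 x" "front_face 1 1 x = face 1 2 x"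
    using back_Suc[of 0 1 x] front_Suc[of 1 0 x] by (simp_all add: numeral_2_eq_2)
  have c: "u (frag_of (face 1 i x)) \<in> carrier R" if "i \<le> 2" for i
    using that x assms by (simp add: numeral_2_eq_2)
  have "coboundary X face 1 u (frag_of x) =
      u (frag_of (face 1 2 x)) \<oplus> (\<ominus> u (frag_of (face 1 1 x)) \<oplus> u (frag_of (face 1 0 x)))"
    unfolding coboundary_value[OF assms(1) x]
    using c[of 0] c[of 1] c[of 2] by (simp add: numeral_2_eq_2 l_minus Pi_def le_Suc_eq)
  then show ?thesis
    unfolding f using c[of 0] c[of 1] c[of 2] by (simp add: a_minus_def a_ac)
qed

lemma coboundary_cup1:
  assumes a: "a \<in> carrier (cochains R X 1)" and b: "b \<in> carrier (cochains R X 1)"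
  shows "coboundary X face 1 (steenrod_cup1 R X face 1 1 a b) =
    \<ominus>\<^bsub>cochains R X 2\<^esub> cup_product R X face 1 1 a b
      \<ominus>\<^bsub>cochains R X 2\<^esub> cup_product R X face 1 1 b a
      \<oplus>\<^bsub>cochains R X 2\<^esub> steenrod_cup1 R X face 2 1 (coboundary X face 1 a) b
      \<oplus>\<^bsub>cochains R X 2\<^esub> steenrod_cup1 R X face 2 1 (coboundary X face 1 b) a
      \<ominus>\<^bsub>cochains R X 2\<^esub> pointwise_product 2 (coboundary X face 1 a) (coboundary X face 1 b)"
    (is "?l = ?r")
proof (rule cochain_eqI)
  interpret M: module R "cochains R X 2"
    by (rule module_cochains)
  note closed = coboundary_1_closed cup1_closed
  show "?l \<in> carrier (cochains R X 2)"
    using a b by (simp add: cup1_1_eq closed del: One_nat_def)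
  show "?r \<in> carrier (cochains R X 2)"
    using a b by (simp add: closed del: One_nat_def)
  fix x assume x: "x \<in> X 2"
  then have "face 1 1 x \<in> X 1"
    by (simp add: numeral_2_eq_2)
  then have c: "a (frag_of (front_face 1 1 x)) \<in> carrier R"
    "a (frag_of (back_face 1 1 x)) \<in> carrier R" "a (frag_of (face 1 1 x)) \<in> carrier R"
    "b (frag_of (front_face 1 1 x)) \<in> carrier R"
    "b (frag_of (back_face 1 1 x)) \<in> carrier R" "b (frag_of (face 1 1 x)) \<in> carrier R"
    using a b x by (simp_all del: One_nat_def)
  show "?l (frag_of x) = ?r (frag_of x)"
    using a b x c \<open>face 1 1 x \<in> X 1\<close>
    by (simp add: cup1_1_eq closed coboundary_1_value cup1_2_value cochains_diff_value
        cochains_neg_value edge_identity del: One_nat_def)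
qed

lemma graded_algebra_cochains:
  assumes "\<exists>n. X n \<noteq> {}"
  shows "graded_algebra R (cochains R X) (cup_product R X face) (unit_cochain R X)"
proof (intro graded_algebra.intro graded_algebra_axioms.intro)
  obtain n where "X n \<noteq> {}"
    using assms ..
  then obtain x where x: "x \<in> X 0"
    using vertices_nonempty[of n] by auto
  show "inj_on (\<lambda>r. r \<odot>\<^bsub>cochains R X 0\<^esub> unit_cochain R X) (carrier R)"
  proof (rule inj_onI)
    fix r s assume rs: "r \<in> carrier R" "s \<in> carrier R"
      and "r \<odot>\<^bsub>cochains R X 0\<^esub> unit_cochain R X = s \<odot>\<^bsub>cochains R X 0\<^esub> unit_cochain R X"
    then have "(r \<odot>\<^bsub>cochains R X 0\<^esub> unit_cochain R X) (frag_of x) =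
        (s \<odot>\<^bsub>cochains R X 0\<^esub> unit_cochain R X) (frag_of x)"
      by (simp only:)
    then show "r = s"
      using x rs by simp
  qed
qed (simp_all add: is_cring module_cochains bilinear_cup cup_assoc unit_closed cup_unit)

lemma dg_algebra_cochains:
  assumes "\<exists>n. X n \<noteq> {}"
  shows "dg_algebra R (cochains R X) (cup_product R X face) (unit_cochain R X) (coboundary X face)"
  using graded_algebra_cochains[OF assms] linear_coboundary coboundary_coboundary coboundary_cup
  by (intro dg_algebra.intro dg_algebra_axioms.intro) simp_all

lemma graded_algebra_cup1_cochains:
  assumes "\<exists>n. X n \<noteq> {}"
  shows "graded_algebra_cup1 R (cochains R X) (cup_product R X face) (unit_cochain R X)
    (\<lambda>p. steenrod_cup1 R X face p 1)"
  using graded_algebra_cochains[OF assms] bilinear_cup1 cup1_hirsch cring_adjoin_scalars_cup1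
  by (intro graded_algebra_cup1.intro graded_algebra_cup1_axioms.intro)

lemma bilinear_pointwise_decomposables:
  fixes D :: "(('x \<Rightarrow>\<^sub>0 int) \<Rightarrow> 'r) set"
  defines "D \<equiv> decomposables R (cochains R X) (cup_product R X face)"
  shows "bilinear_map R ((cochains R X 2)\<lparr>carrier := D\<rparr>) ((cochains R X 2)\<lparr>carrier := D\<rparr>)
    ((cochains R X 2)\<lparr>carrier := D\<rparr>) (pointwise_product 2)"
  unfolding D_def
  by (intro bilinear_map_restrict bilinear_pointwise_product pointwise_product_decomposables
      module.submoduleE(1)[OF module_cochains submodule_decomposables])

lemma cup1_dga_cochains:
  assumes "\<exists>n. X n \<noteq> {}"
  shows "cup1_dga R (cochains R X) (cup_product R X face) (unit_cochain R X)
    (coboundary X face) (\<lambda>p. steenrod_cup1 R X face p 1)"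
proof (intro cup1_dga.intro cup1_dga_axioms.intro)
  show "dg_algebra R (cochains R X) (cup_product R X face) (unit_cochain R X) (coboundary X face)"
    using assms by (rule dg_algebra_cochains)
  show "graded_algebra_cup1 R (cochains R X) (cup_product R X face) (unit_cochain R X)
      (\<lambda>p. steenrod_cup1 R X face p 1)"
    using assms by (rule graded_algebra_cup1_cochains)
qed (use bilinear_pointwise_decomposables pointwise_product_cup coboundary_cup1 in
    \<open>intro exI[of _ "pointwise_product 2"], simp only: Let_def, blast\<close>)

end

theorem theorem4p4:
  fixes R :: "('r, 'k) ring_scheme"
    and X :: "nat \<Rightarrow> 'x set"
    and face :: "nat \<Rightarrow> nat \<Rightarrow> 'x \<Rightarrow> 'x"
  assumes "delta_set X face"
    and "\<exists>n. X n \<noteq> {}"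
    and "cring R"
  shows "cup1_dga R (cochains R X) (cup_product R X face) (unit_cochain R X)
    (coboundary X face) (\<lambda>p. steenrod_cup1 R X face p 1)"
  using assms by (intro delta_set_cochains.cup1_dga_cochains delta_set_cochains.intro)

end
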